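(* For Lebesgue-almost every triangle $\Delta$ (in the space of triangles up to similarity, parametrized by two of its angles $(\alpha,\beta)$ ranging over $\{\alpha>0,\beta>0,\alpha+\beta<\pi\}$ with Lebesgue measure) the following holds. Let $v$ be a vertex of $\Delta$, let $\mu>\sqrt{3}-1$, and let $n_1<n_2<\cdots$ be the increasing enumeration of the (infinite) set of positive integers $n$ with $P_n(v)<e^{n^{\mu}}$. Then for every $\epsilon>0$ and all $i$ large enough, $$n_{i+1}-n_i<n_i^{1+\epsilon}.$$
   Context: Consider the billiard in a triangle $\Delta$. A generalized diagonal is a billiard orbit segment that starts at a vertex of $\Delta$ and ends at a vertex of $\Delta$; its length is its number of reflections. For a vertex $v$ of $\Delta$, $P_n(v)$ denotes the number of generalized diagonals of length at most $n$ emanating from $v$. *)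

theory Defs
  imports "HOL-Analysis.Analysis" "HOL-Library.Infinite_Set"
begin

text \<open>The triangle with angles alpha at vertex 0, beta at vertex 1, realised in the
complex plane with vertices 0, 1 and (sin beta / sin(alpha+beta)) cis alpha.\<close>

definition tri_vert :: "real \<Rightarrow> real \<Rightarrow> nat \<Rightarrow> complex" where
  "tri_vert \<alpha> \<beta> i =
     (if i = 0 then 0 else if i = 1 then 1
      else complex_of_real (sin \<beta> / sin (\<alpha> + \<beta>)) * cis \<alpha>)"

definition tri_verts :: "real \<Rightarrow> real \<Rightarrow> complex set" where
  "tri_verts \<alpha> \<beta> = {tri_vert \<alpha> \<beta> 0, tri_vert \<alpha> \<beta> 1, tri_vert \<alpha> \<beta> 2}"

definition on_side :: "real \<Rightarrow> real \<Rightarrow> complex \<Rightarrow> complex \<Rightarrow> bool" where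
  "on_side \<alpha> \<beta> p u \<longleftrightarrow> (\<exists>i j. i < 3 \<and> j < 3 \<and> i \<noteq> j \<and>
      p \<in> open_segment (tri_vert \<alpha> \<beta> i) (tri_vert \<alpha> \<beta> j) \<and>
      u = sgn (tri_vert \<alpha> \<beta> j - tri_vert \<alpha> \<beta> i))"

text \<open>A generalized diagonal from vertex v, given by its list of break points
[p_0 = v, p_1, ..., p_(k+1)]: p_(k+1) is a vertex, the p_j (0<j<k+1) are reflection
points in the interior of sides, each open segment between consecutive points lies in
the interior of the triangle, and the reflection law holds at each p_j
(reflection across the line of direction u is  z \<mapsto> u^2 * cnj z).
Its length (number of reflections) is  length ps - 2.\<close>
definition gen_diag :: "real \<Rightarrow> real \<Rightarrow> nat \<Rightarrow> complex list \<Rightarrow> bool" where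
  "gen_diag \<alpha> \<beta> v ps \<longleftrightarrow>
     2 \<le> length ps \<and> hd ps = tri_vert \<alpha> \<beta> v \<and> last ps \<in> tri_verts \<alpha> \<beta> \<and>
     (\<forall>j. j + 1 < length ps \<longrightarrow> ps ! j \<noteq> ps ! (j + 1) \<and>
          open_segment (ps ! j) (ps ! (j + 1)) \<subseteq> interior (convex hull tri_verts \<alpha> \<beta>)) \<and>
     (\<forall>j. 0 < j \<and> j + 1 < length ps \<longrightarrow>
          (\<exists>u. on_side \<alpha> \<beta> (ps ! j) u \<and>
               sgn (ps ! (j + 1) - ps ! j) = u\<^sup>2 * cnj (sgn (ps ! j - ps ! (j - 1)))))"

definition diag_count :: "real \<Rightarrow> real \<Rightarrow> nat \<Rightarrow> nat \<Rightarrow> nat" where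
  "diag_count \<alpha> \<beta> v n = card {ps. gen_diag \<alpha> \<beta> v ps \<and> length ps \<le> n + 2}"

end

(*
  Unfold the billiard along the trajectories issued from v. The directions that cross a given sequence
  of sides form a cone; the cone splits whenever an unfolded vertex lies strictly inside it, and
  generalized diagonals correspond to such splittings. Follow a beam with a very thin cone through k
  further reflections. Any three of the vertices at which it splits span a triangle of tiny area. If all
  those vertices are collinear, a beam bounded on both sides by two of them can never split again (the
  line through them lies behind the side just crossed, the next vertex in front of it), so the beam
  splits into at most 2k+1 parts. Otherwise some such area is nonzero but tiny. Up to a scalar, this
  area is a trigonometric polynomial in the two angles with integer coefficients and degree O(k), so its
  sublevel sets are small, and as there are only exponentially many combinatorial types, Borel-Cantelli
  rules this out for almost every triangle as soon as the cone is thinner than exp(-k^(2.2)).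
  Cones that are not thin are few because their widths sum to 1. With k = n^(0.3) and threshold
  exp(-n^(0.7)) this gives fewer than exp(n^(0.73)) generalized diagonals for all large n, where
  0.73 < sqrt 3 - 1. Hence the set of good n is cofinite.
*)
theory Submission
  imports Defs "HOL-Computational_Algebra.Computational_Algebra" "HOL-Real_Asymp.Real_Asymp"
begin

section \<open>Sublevel sets of trigonometric polynomials\<close>

text \<open>Areas must be bounded below independently of how far the beam has travelled. All
  vertices that one beam meets in its next \<open>k\<close> reflections carry the same earlier
  unfolding, which is an isometry; cancelling it leaves words of length at most \<open>k\<close>,
  hence polynomials of degree O(k) and at most 27^(k+2) triples. Some of these polynomials vanish
  identically, so nonvanishing cannot be demanded; what holds almost surely is that an area is
  either exactly zero or at least a gap \<eta>. A nonzero polynomial of degree O(k) is below \<eta>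
  on a set of measure about \<eta>^(c/k), so Borel-Cantelli needs 27^k \<eta>^(c/k) to be summable:
  \<eta> = exp(-k^p) works for p > 2, and p = 11/5 is taken. With k = n^a, the n/k rounds multiply
  the count by (2k+1)^(n/k), about exp(n^(1-a) log n), and wide beams cost exp(n^b) at threshold
  exp(-n^b), where thinness requires b > 11a/5. For a = 3/10 this reads b > 66/100; b = 7/10 = 1 - a
  makes both costs comparable, and 73/100 absorbs the logarithm.\<close>

lemma norm_poly_ge_roots:
  fixes p :: "complex poly"
  assumes "p \<noteq> 0" "0 \<le> \<rho>" "\<And>a. poly p a = 0 \<Longrightarrow> \<rho> \<le> norm (z - a)"
  shows "norm (lead_coeff p) * \<rho> ^ degree p \<le> norm (poly p z)"
  using assms
proof (induction "degree p" arbitrary: p)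
  case 0
  then obtain c where "p = [:c:]" using degree_eq_zeroE by metis
  then show ?case by simp
next
  case (Suc n)
  have "\<not> constant (poly p)"
    using Suc.hyps(2) constant_degree[of p] by simp
  then obtain a where a: "poly p a = 0"
    using fundamental_theorem_of_algebra by blast
  then obtain q where q: "p = [:-a, 1:] * q"
    by (metis poly_eq_0_iff_dvd dvd_def)
  have q0: "q \<noteq> 0" using q Suc.prems by auto
  then have dq: "degree p = Suc (degree q)"
    unfolding q by (subst degree_mult_eq) auto
  have "norm (lead_coeff q) * \<rho> ^ degree q \<le> norm (poly q z)"
    by (rule Suc.hyps(1)) (use dq Suc q q0 in auto)
  moreover have "\<rho> \<le> norm (z - a)" using Suc.prems a by blast
  ultimately have "(norm (lead_coeff q) * \<rho> ^ degree q) * \<rho> \<le> norm (poly q z) * norm (z - a)"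
    using Suc.prems(2) by (intro mult_mono) auto
  moreover have "lead_coeff p = lead_coeff q"
    unfolding q by (subst lead_coeff_mult) simp
  moreover have "norm (poly p z) = norm (poly q z) * norm (z - a)"
    unfolding q by (simp add: norm_mult[symmetric] algebra_simps)
  ultimately show ?case using dq by (simp add: algebra_simps)
qed

section \<open>Chords and arcs of the unit circle\<close>

lemma borel_measurable_cis [measurable]:
  assumes [measurable]: "f \<in> borel_measurable M"
  shows "(\<lambda>x. cis (f x)) \<in> borel_measurable M"
  by (rule measurable_compose[OF assms borel_measurable_continuous_onI])
    (auto intro: continuous_intros)

lemma sin_ge_half:
  assumes "0 \<le> x" "x \<le> pi / 3"
  shows "x / 2 \<le> sin x"
proof -
  have "sin 0 - 0 / 2 \<le> sin x - x / 2"
  proof (rule DERIV_nonneg_imp_nondecreasing[OF assms(1)])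
    fix t assume t: "0 \<le> t" "t \<le> x"
    have "cos (pi / 3) \<le> cos t"
      using t assms by (intro cos_monotone_0_pi_le) auto
    then have "0 \<le> cos t - 1 / 2" by (simp add: cos_60)
    moreover have "((\<lambda>x. sin x - x / 2) has_real_derivative (cos t - 1 / 2)) (at t)"
      by (auto intro!: derivative_eq_intros)
    ultimately show "\<exists>y. ((\<lambda>x. sin x - x / 2) has_real_derivative y) (at t) \<and> 0 \<le> y" by blast
  qed
  then show ?thesis by simp
qed

lemma sin_abs_le: "sin \<bar>x\<bar> \<le> \<bar>sin x\<bar>" for x :: real
  by (cases "0 \<le> x") auto

lemma norm_cis_diff: "norm (cis (2 * s) - cis (2 * t)) = 2 * \<bar>sin (s - t)\<bar>"
proof -
  define d where "d = s - t"
  have "cis (2 * s) - cis (2 * t) = cis (s + t) * (cis d - cis (- d))"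
    by (simp add: cis_mult algebra_simps d_def)
  also have "cis d - cis (- d) = 2 * \<i> * sin d"
    by (simp add: complex_eq_iff)
  finally show ?thesis by (simp add: norm_mult d_def)
qed

text \<open>The centre \<open>a\<close> may lie off the circle, so distances are taken from a point
  \<open>t0\<close> of the set itself, which doubles the radius. On an interval of length pi/3 the
  chord controls the arc: |t - t0| is at most 2 |sin (t - t0)|.\<close>

lemma emeasure_small_arc:
  assumes r: "0 < r"
  shows "emeasure lborel {t \<in> {s..s + pi / 3}. norm (cis (2 * t) - a) < r} \<le> ennreal (4 * r)"
proof (cases "{t \<in> {s..s + pi / 3}. norm (cis (2 * t) - a) < r} = {}")
  case False
  then obtain t0 where t0: "t0 \<in> {s..s + pi / 3}" "norm (cis (2 * t0) - a) < r" by auto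
  have "{t \<in> {s..s + pi / 3}. norm (cis (2 * t) - a) < r} \<subseteq> {t0 - 2 * r..t0 + 2 * r}"
  proof
    fix t assume t: "t \<in> {t \<in> {s..s + pi / 3}. norm (cis (2 * t) - a) < r}"
    have "norm (cis (2 * t) - cis (2 * t0)) < 2 * r"
      using t t0 norm_triangle_ineq4[of "cis (2 * t) - a" "cis (2 * t0) - a"] by simp
    then have "\<bar>sin (t - t0)\<bar> < r" unfolding norm_cis_diff by simp
    moreover have "\<bar>t - t0\<bar> \<le> pi / 3"
    proof -
      have "s \<le> t" "t \<le> s + pi / 3" "s \<le> t0" "t0 \<le> s + pi / 3" using t t0 by auto
      then show ?thesis by linarith
    qed
    then have "\<bar>t - t0\<bar> / 2 \<le> sin \<bar>t - t0\<bar>"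
      by (intro sin_ge_half) auto
    moreover have "sin \<bar>t - t0\<bar> \<le> \<bar>sin (t - t0)\<bar>"
      by (rule sin_abs_le)
    ultimately show "t \<in> {t0 - 2 * r..t0 + 2 * r}" by auto
  qed
  then have "emeasure lborel {t \<in> {s..s + pi / 3}. norm (cis (2 * t) - a) < r}
      \<le> emeasure lborel {t0 - 2 * r..t0 + 2 * r}"
    by (intro emeasure_mono) auto
  then show ?thesis using r by simp
next
  case True
  show ?thesis unfolding True by simp
qed

lemma emeasure_arc:
  assumes r: "0 < r"
  shows "emeasure lborel {t \<in> {0<..<pi}. norm (cis (2 * t) - a) < r} \<le> ennreal (12 * r)"
proof -
  define A where "A = (\<lambda>n::nat. {t \<in> {real n * pi / 3..real n * pi / 3 + pi / 3}. norm (cis (2 * t) - a) < r})"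
  have meas: "A n \<in> sets lborel" for n unfolding A_def by measurable
  have "{t \<in> {0<..<pi}. norm (cis (2 * t) - a) < r} \<subseteq> (\<Union>n\<in>{..<3}. A n)"
  proof
    fix t assume t: "t \<in> {t \<in> {0<..<pi}. norm (cis (2 * t) - a) < r}"
    then consider "t \<le> pi / 3" | "pi / 3 \<le> t" "t \<le> 2 * pi / 3" | "2 * pi / 3 \<le> t" by linarith
    then have "t \<in> A 0 \<or> t \<in> A 1 \<or> t \<in> A 2"
      by cases (use t in \<open>auto simp: A_def field_simps\<close>)
    then show "t \<in> (\<Union>n\<in>{..<3}. A n)" by (auto simp: numeral_3_eq_3)
  qed
  then have "emeasure lborel {t \<in> {0<..<pi}. norm (cis (2 * t) - a) < r} \<le> emeasure lborel (\<Union>n\<in>{..<3}. A n)"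
    by (intro emeasure_mono) (use meas in auto)
  also have "\<dots> \<le> (\<Sum>n<3. emeasure lborel (A n))"
    by (intro emeasure_subadditive_finite) (use meas in auto)
  also have "\<dots> \<le> (\<Sum>n<(3::nat). ennreal (4 * r))"
    unfolding A_def using r by (intro sum_mono emeasure_small_arc)
  also have "\<dots> = ennreal (12 * r)"
    using r by (simp add: ennreal_mult[symmetric] flip: ennreal_numeral)
  finally show ?thesis .
qed

section \<open>Sublevel sets in one and in two angles\<close>

text \<open>A polynomial is its leading coefficient times the product of the distances to its roots.
  If the value is below \<eta>, some root is within (\<eta>/\<epsilon>)^(1/D), so at most
  \<open>D\<close> small arcs cover the set.\<close>

lemma emeasure_sublevel_trig_poly:
  fixes a :: "nat \<Rightarrow> complex"
  assumes "J \<le> D" "1 \<le> D" "0 < \<epsilon>" "\<epsilon> \<le> norm (a J)" "0 < \<eta>" "\<eta> \<le> \<epsilon>"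
  shows "emeasure lborel {t \<in> {0<..<pi}. norm (\<Sum>j\<le>J. a j * cis (2 * t) ^ j) < \<eta>}
           \<le> ennreal (12 * real D * (\<eta> / \<epsilon>) powr (1 / real D))"
proof -
  define p where "p = (\<Sum>j\<le>J. monom (a j) j)"
  have coeff: "coeff p n = (if n \<le> J then a n else 0)" for n
    unfolding p_def by (simp add: coeff_sum sum.delta)
  have aJ: "a J \<noteq> 0" using assms by auto
  have deg: "degree p = J"
    by (intro antisym degree_le le_degree) (use aJ coeff in auto)
  have p0: "p \<noteq> 0" using coeff[of J] aJ by auto
  have poly: "poly p z = (\<Sum>j\<le>J. a j * z ^ j)" for z
    unfolding poly_altdef deg by (simp add: coeff)
  define \<rho> where "\<rho> = (\<eta> / \<epsilon>) powr (1 / real D)"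
  have q01: "0 < \<eta> / \<epsilon>" "\<eta> / \<epsilon> \<le> 1" using assms by auto
  have \<rho>: "0 < \<rho>" "\<rho> \<le> 1"
    unfolding \<rho>_def using q01 assms by (auto intro!: powr_le1)
  have \<rho>D: "\<rho> ^ D = \<eta> / \<epsilon>"
    unfolding \<rho>_def using q01 assms by (simp add: powr_realpow[symmetric] powr_powr)
  define A where "A = (\<lambda>z. {t \<in> {0<..<pi}. norm (cis (2 * t) - z) < \<rho>})"
  have meas: "A z \<in> sets lborel" for z unfolding A_def by measurable
  have fin: "finite {z. poly p z = 0}" using p0 poly_roots_finite by blast
  have "{t \<in> {0<..<pi}. norm (\<Sum>j\<le>J. a j * cis (2 * t) ^ j) < \<eta>} \<subseteq> (\<Union>z\<in>{z. poly p z = 0}. A z)"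
  proof
    fix t assume t: "t \<in> {t \<in> {0<..<pi}. norm (\<Sum>j\<le>J. a j * cis (2 * t) ^ j) < \<eta>}"
    show "t \<in> (\<Union>z\<in>{z. poly p z = 0}. A z)"
    proof (rule ccontr)
      assume "t \<notin> (\<Union>z\<in>{z. poly p z = 0}. A z)"
      then have "\<And>z. poly p z = 0 \<Longrightarrow> \<rho> \<le> norm (cis (2 * t) - z)"
        using t by (auto simp: A_def)
      then have "norm (a J) * \<rho> ^ J \<le> norm (poly p (cis (2 * t)))"
        using norm_poly_ge_roots[OF p0, of \<rho> "cis (2 * t)"] \<rho> deg coeff[of J] by auto
      moreover have "\<epsilon> * \<rho> ^ D \<le> norm (a J) * \<rho> ^ J"
        using assms \<rho> by (intro mult_mono power_decreasing) auto
      moreover have "\<epsilon> * \<rho> ^ D = \<eta>" using \<rho>D assms by simp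
      ultimately show False using t poly by auto
    qed
  qed
  then have "emeasure lborel {t \<in> {0<..<pi}. norm (\<Sum>j\<le>J. a j * cis (2 * t) ^ j) < \<eta>}
      \<le> emeasure lborel (\<Union>z\<in>{z. poly p z = 0}. A z)"
    by (intro emeasure_mono) (use meas fin in auto)
  also have "\<dots> \<le> (\<Sum>z\<in>{z. poly p z = 0}. emeasure lborel (A z))"
    by (intro emeasure_subadditive_finite) (use meas fin in auto)
  also have "\<dots> \<le> (\<Sum>z\<in>{z. poly p z = 0}. ennreal (12 * \<rho>))"
    unfolding A_def by (intro sum_mono emeasure_arc \<rho>)
  also have "\<dots> = ennreal (real (card {z. poly p z = 0}) * (12 * \<rho>))"
    using \<rho> by (simp add: ennreal_mult ennreal_of_nat_eq_real_of_nat)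
  also have "\<dots> \<le> ennreal (real D * (12 * \<rho>))"
    using card_poly_roots_bound[OF p0] deg assms \<rho> by (intro ennreal_leI mult_right_mono) auto
  finally show ?thesis by (simp add: \<rho>_def mult_ac)
qed

text \<open>Fubini over the first angle \<open>s\<close>. The leading coefficient
  \<open>q J s\<close> in the second angle is a polynomial in \<open>s\<close> whose own leading
  coefficient is a nonzero integer, hence of modulus at least 1; this is what frees the bound from
  the size of the coefficients. For few \<open>s\<close> the value \<open>q J s\<close> is small;
  for all other \<open>s\<close> the slice is small.\<close>

lemma emeasure_sublevel_trig_poly2:
  fixes c :: "nat \<Rightarrow> nat \<Rightarrow> int"
  assumes nz: "\<exists>i\<le>D. \<exists>j\<le>D. c i j \<noteq> 0" and D: "1 \<le> D" and \<eta>: "0 < \<eta>" "\<eta> \<le> 1"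
  shows "emeasure lborel {x :: real \<times> real. fst x \<in> {0<..<pi} \<and> snd x \<in> {0<..<pi} \<and>
           norm (\<Sum>i\<le>D. \<Sum>j\<le>D. of_int (c i j) * cis (2 * fst x) ^ i * cis (2 * snd x) ^ j) < \<eta>}
           \<le> ennreal (24 * pi * real D * \<eta> powr (1 / (2 * real D)))" (is "emeasure _ ?X \<le> _")
proof -
  define J where "J = Max {j. j \<le> D \<and> (\<exists>i\<le>D. c i j \<noteq> 0)}"
  have "J \<in> {j. j \<le> D \<and> (\<exists>i\<le>D. c i j \<noteq> 0)}"
    unfolding J_def by (rule Max_in) (use nz in auto)
  then have J: "J \<le> D" "\<exists>i\<le>D. c i J \<noteq> 0" by auto
  have Jmax: "c i j = 0" if "i \<le> D" "j \<le> D" "J < j" for i j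
  proof (rule ccontr)
    assume "c i j \<noteq> 0"
    then have "j \<le> J" unfolding J_def using that by (intro Max_ge) auto
    then show False using that by simp
  qed
  define I where "I = Max {i. i \<le> D \<and> c i J \<noteq> 0}"
  have "I \<in> {i. i \<le> D \<and> c i J \<noteq> 0}"
    unfolding I_def by (rule Max_in) (use J in auto)
  then have I: "I \<le> D" "c I J \<noteq> 0" by auto
  have Imax: "c i J = 0" if "i \<le> D" "I < i" for i
  proof (rule ccontr)
    assume "c i J \<noteq> 0"
    then have "i \<le> I" unfolding I_def using that by (intro Max_ge) auto
    then show False using that by simp
  qed
  define q where "q = (\<lambda>j s. \<Sum>i\<le>D. of_int (c i j) * cis (2 * s) ^ i)"
  have F: "(\<Sum>i\<le>D. \<Sum>j\<le>D. of_int (c i j) * cis (2 * s) ^ i * cis (2 * t) ^ j)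
      = (\<Sum>j\<le>J. q j s * cis (2 * t) ^ j)" for s t
  proof -
    have "(\<Sum>i\<le>D. \<Sum>j\<le>D. of_int (c i j) * cis (2 * s) ^ i * cis (2 * t) ^ j)
      = (\<Sum>j\<le>D. q j s * cis (2 * t) ^ j)"
      unfolding q_def sum_distrib_right by (rule sum.swap)
    also have "\<dots> = (\<Sum>j\<le>J. q j s * cis (2 * t) ^ j)"
      by (rule sum.mono_neutral_right) (use J Jmax in \<open>auto simp: q_def\<close>)
    finally show ?thesis .
  qed
  have qJ: "q J s = (\<Sum>i\<le>I. of_int (c i J) * cis (2 * s) ^ i)" for s
    unfolding q_def by (rule sum.mono_neutral_right) (use I Imax in auto)
  \<comment> \<open>The square root balances the two cases: one compares \<open>e\<close> with 1,
    the other \<eta> with \<open>e\<close>, and both ratios equal \<open>e\<close>.\<close>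
  define e where "e = sqrt \<eta>"
  have e: "0 < e" "e \<le> 1" "\<eta> \<le> e" "\<eta> / e = e"
    using \<eta> by (auto simp: e_def real_div_sqrt real_le_rsqrt power2_eq_square mult_left_le)
  have epow: "e powr (1 / real D) = \<eta> powr (1 / (2 * real D))"
    using \<eta> by (simp add: e_def powr_half_sqrt[symmetric] powr_powr)
  define K where "K = 12 * real D * e powr (1 / real D)"
  have K: "0 \<le> K" by (simp add: K_def)
  define A where "A = {s \<in> {0<..<pi}. norm (q J s) < e}"
  have "1 \<le> norm (of_int (c I J) :: complex)"
    using I by (simp add: of_int_leD)
  then have A: "emeasure lborel A \<le> ennreal K"
    using emeasure_sublevel_trig_poly[of I D 1 "\<lambda>i. of_int (c i J)" e] I D e
    unfolding A_def K_def qJ by simp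
  have mA [measurable]: "A \<in> sets lborel" unfolding A_def q_def by measurable
  have "?X = {x \<in> space (lborel \<Otimes>\<^sub>M lborel). fst x \<in> {0<..<pi} \<and> snd x \<in> {0<..<pi} \<and>
           norm (\<Sum>i\<le>D. \<Sum>j\<le>D. of_int (c i j) * cis (2 * fst x) ^ i * cis (2 * snd x) ^ j) < \<eta>}"
    by (simp add: space_pair_measure)
  also have "\<dots> \<in> sets (lborel \<Otimes>\<^sub>M lborel)"
    by measurable
  finally have mX: "?X \<in> sets (lborel \<Otimes>\<^sub>M lborel)" .
  have slice: "emeasure lborel (Pair s -` ?X)
      \<le> ennreal pi * indicator A s + ennreal K * indicator {0<..<pi} s" for s
  proof (cases "s \<in> {0<..<pi}")
    case s: True
    show ?thesis
    proof (cases "s \<in> A")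
      case True
      have "emeasure lborel (Pair s -` ?X) \<le> emeasure lborel {0<..<pi}"
        by (intro emeasure_mono) auto
      then show ?thesis using True s by (simp add: add_increasing2)
    next
      case False
      then have "emeasure lborel {t \<in> {0<..<pi}. norm (\<Sum>j\<le>J. q j s * cis (2 * t) ^ j) < \<eta>}
          \<le> ennreal K"
        using emeasure_sublevel_trig_poly[of J D e "\<lambda>j. q j s" \<eta>] J D e \<eta> s
        unfolding A_def K_def by simp
      moreover have "Pair s -` ?X = {t \<in> {0<..<pi}. norm (\<Sum>j\<le>J. q j s * cis (2 * t) ^ j) < \<eta>}"
        using s by (auto simp: F)
      ultimately show ?thesis using False s by simp
    qed
  next
    case False
    then have e: "Pair s -` ?X = {}" by auto
    show ?thesis unfolding e by simp
  qed
  have "emeasure lborel ?X = emeasure (lborel \<Otimes>\<^sub>M lborel) ?X" by (simp add: lborel_prod)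
  also have "\<dots> = (\<integral>\<^sup>+ s. emeasure lborel (Pair s -` ?X) \<partial>lborel)"
    by (rule lborel.emeasure_pair_measure_alt[OF mX])
  also have "\<dots> \<le> (\<integral>\<^sup>+ s. ennreal pi * indicator A s + ennreal K * indicator {0<..<pi} s \<partial>lborel)"
    by (intro nn_integral_mono slice)
  also have "\<dots> = ennreal pi * emeasure lborel A + ennreal K * ennreal pi"
    using nn_integral_cmult_indicator[OF mA, of "ennreal pi"]
    by (subst nn_integral_add) (auto simp: nn_integral_cmult_indicator)
  also have "\<dots> \<le> ennreal pi * ennreal K + ennreal K * ennreal pi"
    by (intro add_right_mono mult_left_mono A) auto
  also have "\<dots> = ennreal (24 * pi * real D * \<eta> powr (1 / (2 * real D)))"
    using K by (simp add: ennreal_mult[symmetric] ennreal_plus[symmetric] epow K_def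
        algebra_simps del: ennreal_plus)
  finally show ?thesis .
qed

section \<open>Beams in the plane\<close>

text \<open>The planar cross product, positive when \<open>q\<close> lies to the left of the ray
  through \<open>p\<close>. The position of beams and vertices is expressed by signs of
  \<open>cr\<close> and \<open>orient\<close>, never by angles.\<close>

definition cr :: "complex \<Rightarrow> complex \<Rightarrow> real" where
  "cr p q = Im (cnj p * q)"

definition orient :: "complex \<Rightarrow> complex \<Rightarrow> complex \<Rightarrow> real" where
  "orient p q s = cr (q - p) (s - p)"

lemma cr_alt: "cr p q = Re p * Im q - Im p * Re q"
  by (simp add: cr_def)

lemma cr_self [simp]: "cr p p = 0"
  by (simp add: cr_alt)

lemma cr_antisym: "cr p q = - cr q p"
  by (simp add: cr_alt)

lemma cr_plucker: "cr p q * cr y x = cr y q * cr p x - cr y p * cr q x"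
  by (simp add: cr_alt algebra_simps)

lemma cr_cnj: "cr (cnj p) (cnj q) = cr q p"
  by (simp add: cr_alt algebra_simps)

lemma abs_cr_le: "\<bar>cr p q\<bar> \<le> cmod p * cmod q"
  by (metis abs_Im_le_cmod complex_mod_cnj cr_def norm_mult)

lemma orient_alt: "orient p y x = cr y x - cr y p - cr p x"
  by (simp add: orient_def cr_alt algebra_simps)

lemma orient_translate: "orient (p - c) (q - c) (s - c) = orient p q s"
  by (simp add: orient_def)

definition sbetween :: "complex \<Rightarrow> complex \<Rightarrow> complex \<Rightarrow> bool" where
  "sbetween r z l \<longleftrightarrow> 0 < cr r z \<and> 0 < cr z l"

text \<open>The source of the beam is the origin. \<open>x\<close> and \<open>y\<close> are the left
  and right endpoints of the side just crossed, \<open>z\<close> is the vertex beyond it, and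
  \<open>l\<close>, \<open>r\<close> are points on the left and right bounding rays. The weak
  \<open>orient\<close> inequalities keep \<open>l\<close> and \<open>r\<close> from lying beyond
  the line of that side; this is what makes collinear splittings impossible.\<close>

definition beam :: "complex \<Rightarrow> complex \<Rightarrow> complex \<Rightarrow> complex \<Rightarrow> complex \<Rightarrow> bool" where
  "beam x y z l r \<longleftrightarrow> 0 < cr y x \<and> 0 \<le> cr y r \<and> 0 \<le> cr r x \<and> 0 \<le> cr y l \<and> 0 \<le> cr l x \<and>
     0 < cr r l \<and> 0 \<le> orient l y x \<and> 0 \<le> orient r y x \<and> orient z y x < 0"

lemma cr_basis:
  assumes "cr y x > 0"
  obtains a b where "p = of_real a * x + of_real b * y" "cr y p = a * cr y x" "cr p x = b * cr y x"
proof
  let ?D = "cr y x"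
  show "p = of_real (cr y p / ?D) * x + of_real (cr p x / ?D) * y"
    using assms by (auto simp: complex_eq_iff cr_alt divide_simps) (simp_all add: algebra_simps)
qed (use assms in auto)

lemma cr_comb:
  "cr (of_real a * x + of_real b * y) (of_real c * x + of_real d * y) = (b * c - a * d) * cr y x"
  by (simp add: cr_alt algebra_simps)

lemma orient_comb:
  "orient (of_real a * x + of_real b * y) y x = (1 - a - b) * cr y x"
  by (simp add: orient_alt cr_alt algebra_simps)

text \<open>In the basis \<open>x\<close>, \<open>y\<close> the hypothesis al + bl \<le> 1 puts a
  bounding point on the near side of the line through \<open>x\<close> and \<open>y\<close>; the
  conclusion puts it on the near side of the line through \<open>x\<close> and z = c x + d y. The
  expression equals d (1 - al - bl) + bl (c + d - 1).\<close>

lemma near_preserved: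
  fixes al bl c d :: real
  assumes "0 \<le> bl" "al + bl \<le> 1" "1 < c + d" "0 < d"
  shows "0 \<le> d - (d * al - c * bl) - bl"
proof -
  have "0 \<le> d * (1 - al - bl)" "0 \<le> bl * (c + d - 1)"
    using assms by auto
  then show ?thesis by (simp add: algebra_simps)
qed

lemma orient_comb2:
  "orient (of_real a * x + of_real b * y) (of_real c * x + of_real d * y) x
    = (d - (d * a - c * b) - b) * cr y x"
  by (simp add: orient_alt cr_alt algebra_simps)

text \<open>With \<open>z\<close> on or to the right of the right bounding ray, the whole beam
  leaves through the side from \<open>x\<close> to \<open>z\<close>, so \<open>z\<close> replaces
  \<open>y\<close> as right endpoint. In coordinates with respect to \<open>x\<close> and
  \<open>y\<close> each condition becomes a polynomial inequality.\<close>

lemma beam_left: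
  assumes B: "beam x y z l r" and z: "cr r z \<le> 0" and z': "orient z' z x < 0"
  shows "beam x z z' l r"
proof -
  define D where "D = cr y x"
  have D: "D > 0" using B by (simp add: beam_def D_def)
  obtain al bl where l: "l = of_real al * x + of_real bl * y" and lc: "cr y l = al * D" "cr l x = bl * D"
    using cr_basis[of y x l] D D_def by metis
  obtain ar br where r: "r = of_real ar * x + of_real br * y" and rc: "cr y r = ar * D" "cr r x = br * D"
    using cr_basis[of y x r] D D_def by metis
  obtain c d where zz: "z = of_real c * x + of_real d * y" and zc: "cr y z = c * D" "cr z x = d * D"
    using cr_basis[of y x z] D D_def by metis
  have ol: "orient l y x = (1 - al - bl) * D" "orient r y x = (1 - ar - br) * D"
      "orient z y x = (1 - c - d) * D"
    unfolding l r zz orient_comb D_def by simp_all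
  have crl: "cr r l = (br * al - ar * bl) * D" "cr r z = (br * c - ar * d) * D"
      "cr z l = (d * al - c * bl) * D"
    unfolding l r zz cr_comb D_def by simp_all
  have nn: "0 \<le> al" "0 \<le> bl" "0 \<le> ar" "0 \<le> br" "al + bl \<le> 1" "ar + br \<le> 1" "1 < c + d"
    using B D unfolding beam_def ol lc rc by (auto simp: zero_le_mult_iff mult_less_0_iff)
  have rl: "br * al > ar * bl"
    using B D unfolding beam_def crl by (auto simp: zero_less_mult_iff)
  have rz: "br * c \<le> ar * d"
    using z D unfolding crl by (auto simp: mult_le_0_iff)
  have br: "br > 0"
  proof (rule ccontr)
    assume "\<not> br > 0"
    then have "br = 0" using nn by simp
    moreover have "0 \<le> ar * bl" using nn by simp
    ultimately show False using rl by simp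
  qed
  have d: "d > 0"
  proof (rule ccontr)
    assume "\<not> d > 0"
    then have "c > 1" "ar * d \<le> 0" using nn by (auto simp: mult_nonneg_nonpos)
    then show False using rz mult_pos_pos[OF br, of c] by simp
  qed
  have "d * (ar * bl) \<le> d * (br * al)" "bl * (br * c) \<le> bl * (ar * d)"
    using rl rz d nn by (auto intro: mult_left_mono)
  then have "br * (c * bl) \<le> br * (d * al)" by (simp add: algebra_simps)
  then have zl: "c * bl \<le> d * al" using br by simp
  have "orient l z x = (d - (d * al - c * bl) - bl) * D" "orient r z x = (d - (d * ar - c * br) - br) * D"
    unfolding l r zz orient_comb2 D_def by simp_all
  then have "0 \<le> orient l z x" "0 \<le> orient r z x"
    using nn d D near_preserved[of bl al c d] near_preserved[of br ar c d] by simp_all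
  moreover have "0 \<le> cr z l" "0 \<le> cr z r" "0 < cr z x"
    using zl z d D unfolding crl zc cr_antisym[of z r] by auto
  ultimately show ?thesis using B z' by (auto simp: beam_def)
qed

lemma beam_split_left:
  assumes B: "beam x y z l r" and z: "sbetween r z l" and z': "orient z' z x < 0"
  shows "beam x z z' l z"
proof -
  define D where "D = cr y x"
  have D: "D > 0" using B by (simp add: beam_def D_def)
  obtain al bl where l: "l = of_real al * x + of_real bl * y" and lc: "cr y l = al * D" "cr l x = bl * D"
    using cr_basis[of y x l] D D_def by metis
  obtain c d where zz: "z = of_real c * x + of_real d * y" and zc: "cr y z = c * D" "cr z x = d * D"
    using cr_basis[of y x z] D D_def by metis
  have ol: "orient l y x = (1 - al - bl) * D" "orient z y x = (1 - c - d) * D"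
    unfolding l zz orient_comb D_def by simp_all
  have crl: "cr z l = (d * al - c * bl) * D"
    unfolding l zz cr_comb D_def by simp_all
  have nn: "0 \<le> al" "0 \<le> bl" "al + bl \<le> 1" "1 < c + d"
    using B D unfolding beam_def ol lc by (auto simp: zero_le_mult_iff mult_less_0_iff)
  have zl: "c * bl < d * al"
    using z D unfolding sbetween_def crl by (auto simp: zero_less_mult_iff)
  have d: "d > 0"
  proof (rule ccontr)
    assume "\<not> d > 0"
    then have "c > 1" "d * al \<le> 0" using nn by (auto simp: mult_nonpos_nonneg)
    moreover have "0 \<le> c * bl" using \<open>c > 1\<close> nn by simp
    ultimately show False using zl by linarith
  qed
  have "orient l z x = (d - (d * al - c * bl) - bl) * D"
    unfolding l zz orient_comb2 D_def by simp
  then have "0 \<le> orient l z x"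
    using nn d D near_preserved[of bl al c d] by simp
  moreover have "0 < cr z x" using d D zc by simp
  moreover have "orient z z x = 0" by (simp add: orient_def cr_alt)
  ultimately show ?thesis using B z z' by (auto simp: beam_def sbetween_def)
qed

lemma orient_cnj: "orient (cnj p) (cnj q) (cnj s) = orient p s q"
  by (simp add: orient_alt cr_alt algebra_simps)

text \<open>Conjugation mirrors the plane and exchanges left and right, so the statements about
  right turns follow from those about left turns.\<close>

lemma beam_cnj: "beam (cnj x) (cnj y) (cnj z) (cnj l) (cnj r) \<longleftrightarrow> beam y x z r l"
  unfolding beam_def orient_cnj cr_cnj by auto

lemma beam_right:
  assumes "beam x y z l r" "cr z l \<le> 0" "orient z' y z < 0"
  shows "beam z y z' l r"
  using beam_left[of "cnj y" "cnj x" "cnj z" "cnj r" "cnj l" "cnj z'"] assms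
  by (simp add: beam_cnj cr_cnj orient_cnj)

lemma beam_split_right:
  assumes "beam x y z l r" "sbetween r z l" "orient z' y z < 0"
  shows "beam z y z' z r"
  using beam_split_left[of "cnj y" "cnj x" "cnj z" "cnj r" "cnj l" "cnj z'"] assms
  by (simp add: beam_cnj cr_cnj orient_cnj sbetween_def)

text \<open>If the three points were collinear, \<open>z\<close> would lie on the segment from
  \<open>r\<close> to \<open>l\<close>, whose ends are on the near side of the side just crossed,
  whereas \<open>z\<close> is beyond it. The identity \<open>id\<close> is this convex combination
  multiplied by \<open>cr r l\<close>.\<close>

lemma beam_not_collinear:
  assumes B: "beam x y z l r" and z: "sbetween r z l"
  shows "orient r z l \<noteq> 0"
proof
  assume "orient r z l = 0"
  then have s: "cr r l = cr z l + cr r z" by (simp add: orient_alt cr_antisym[of z r])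
  have id: "cr r l * orient z y x = cr r z * orient l y x + cr z l * orient r y x"
    unfolding orient_alt cr_plucker[of r l] using s
    by (simp add: cr_alt) algebra
  have "0 \<le> cr r z * orient l y x + cr z l * orient r y x"
    using B z by (auto simp: beam_def sbetween_def)
  moreover have "cr r l * orient z y x < 0"
    using B by (auto simp: beam_def mult_pos_neg)
  ultimately show False using id by simp
qed

section \<open>Unfolded triangles\<close>

inductive trig_poly :: "nat \<Rightarrow> (real \<Rightarrow> real \<Rightarrow> complex) \<Rightarrow> bool" for d :: nat where
  trig_poly_0: "trig_poly d (\<lambda>a b. 0)"
| trig_poly_term: "\<bar>i\<bar> \<le> int d \<Longrightarrow> \<bar>j\<bar> \<le> int d \<Longrightarrow> trig_poly d F \<Longrightarrow>
     trig_poly d (\<lambda>a b. of_int c * cis (2 * (of_int i * a + of_int j * b)) + F a b)"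

lemma trig_poly_add:
  assumes "trig_poly d F" "trig_poly d G"
  shows "trig_poly d (\<lambda>a b. F a b + G a b)"
  using assms
proof induction
  case (trig_poly_term i j F c)
  then show ?case
    using trig_poly.trig_poly_term[of i d j "\<lambda>a b. F a b + G a b" c] by (simp add: add.assoc)
qed simp

lemma trig_poly_mono:
  assumes "trig_poly d F" "d \<le> e"
  shows "trig_poly e F"
  using assms(1)
proof induction
  case (trig_poly_term i j F c)
  then show ?case using assms(2) by (intro trig_poly.trig_poly_term) auto
qed (rule trig_poly_0)

lemma trig_poly_monom:
  assumes "\<bar>i\<bar> \<le> int d" "\<bar>j\<bar> \<le> int d"
  shows "trig_poly d (\<lambda>a b. of_int c * cis (2 * (of_int i * a + of_int j * b)))"
  using trig_poly_term[OF assms trig_poly_0, of c] by simp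

lemma trig_poly_shift:
  assumes "trig_poly d F" "\<bar>k\<bar> \<le> int e" "\<bar>l\<bar> \<le> int e"
  shows "trig_poly (d + e) (\<lambda>a b. of_int m * cis (2 * (of_int k * a + of_int l * b)) * F a b)"
  using assms(1)
proof induction
  case trig_poly_0
  then show ?case by (simp add: trig_poly.trig_poly_0)
next
  case (trig_poly_term i j F c)
  have "trig_poly (d + e) (\<lambda>a b. of_int (m * c) * cis (2 * (of_int (k + i) * a + of_int (l + j) * b)) +
      of_int m * cis (2 * (of_int k * a + of_int l * b)) * F a b)"
    by (intro trig_poly.trig_poly_term) (use trig_poly_term assms in auto)
  then show ?case
    by (simp add: algebra_simps flip: cis_mult)
qed

lemma trig_poly_cnj:
  assumes "trig_poly d F"
  shows "trig_poly d (\<lambda>a b. cnj (F a b))"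
  using assms
proof induction
  case trig_poly_0
  then show ?case by (simp add: trig_poly.trig_poly_0)
next
  case (trig_poly_term i j F c)
  then have "trig_poly d (\<lambda>a b. of_int c * cis (2 * (of_int (- i) * a + of_int (- j) * b)) + cnj (F a b))"
    by (intro trig_poly.trig_poly_term) auto
  then show ?case by (simp add: cis_cnj algebra_simps)
qed

lemma trig_poly_mult:
  assumes "trig_poly d F" "trig_poly e G"
  shows "trig_poly (d + e) (\<lambda>a b. F a b * G a b)"
  using assms(1)
proof induction
  case trig_poly_0
  then show ?case by (simp add: trig_poly.trig_poly_0)
next
  case (trig_poly_term i j F c)
  then show ?case
    using trig_poly_add[OF trig_poly_shift[OF assms(2), of i d j c]] by (simp add: algebra_simps)
qed

lemma trig_poly_uminus:
  assumes "trig_poly d F"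
  shows "trig_poly d (\<lambda>a b. - F a b)"
  using trig_poly_shift[OF assms, of 0 0 0 "-1"] by simp

lemma trig_poly_diff:
  assumes "trig_poly d F" "trig_poly d G"
  shows "trig_poly d (\<lambda>a b. F a b - G a b)"
  using trig_poly_add[OF assms(1) trig_poly_uminus[OF assms(2)]] by simp

text \<open>The factor of modulus 1 shifts all frequencies from [-d, d] to [0, 2d], so an ordinary
  polynomial in \<open>cis (2 * a)\<close> and \<open>cis (2 * b)\<close> with the same modulus
  results.\<close>

lemma trig_poly_coeffs:
  assumes "trig_poly d F"
  shows "\<exists>c :: nat \<Rightarrow> nat \<Rightarrow> int. \<forall>a b. F a b * cis (2 * real d * (a + b)) =
    (\<Sum>i\<le>2*d. \<Sum>j\<le>2*d. of_int (c i j) * cis (2 * a) ^ i * cis (2 * b) ^ j)"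
  using assms
proof induction
  case trig_poly_0
  show ?case by (rule exI[of _ "\<lambda>i j. 0"]) simp
next
  case (trig_poly_term i j F m)
  then obtain c :: "nat \<Rightarrow> nat \<Rightarrow> int" where c: "\<And>a b. F a b * cis (2 * real d * (a + b)) =
    (\<Sum>i\<le>2*d. \<Sum>j\<le>2*d. of_int (c i j) * cis (2 * a) ^ i * cis (2 * b) ^ j)" by blast
  define p q where "p = nat (i + int d)" and "q = nat (j + int d)"
  have pq: "p \<le> 2 * d" "q \<le> 2 * d" "real p = of_int i + real d" "real q = of_int j + real d"
    using trig_poly_term.hyps by (auto simp: p_def q_def)
  let ?c = "\<lambda>i j. c i j + (if i = p then if j = q then m else 0 else 0)"
  have "(of_int m * cis (2 * (of_int i * a + of_int j * b)) + F a b) * cis (2 * real d * (a + b)) =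
    (\<Sum>i\<le>2*d. \<Sum>j\<le>2*d. of_int (?c i j) * cis (2 * a) ^ i * cis (2 * b) ^ j)" for a b
  proof -
    have "(\<Sum>j\<le>2*d. of_int (if i = p then if j = q then m else 0 else 0) * cis (2 * a) ^ i * cis (2 * b) ^ j)
      = (if i = p then of_int m * cis (2 * a) ^ p * cis (2 * b) ^ q else 0)" for i
    proof (cases "i = p")
      case True
      have "(\<Sum>j\<le>2*d. of_int (if i = p then if j = q then m else 0 else 0) * cis (2 * a) ^ i * cis (2 * b) ^ j)
        = (\<Sum>j\<le>2*d. if j = q then of_int m * cis (2 * a) ^ p * cis (2 * b) ^ q else 0)"
        using True by (intro sum.cong refl) auto
      then show ?thesis using True pq by simp
    qed simp
    then have "(\<Sum>i\<le>2*d. \<Sum>j\<le>2*d. of_int (if i = p then if j = q then m else 0 else 0) * cis (2 * a) ^ i * cis (2 * b) ^ j)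
      = (\<Sum>i\<le>2*d. if i = p then of_int m * cis (2 * a) ^ p * cis (2 * b) ^ q else 0)"
      by simp
    also have "\<dots> = of_int m * cis (2 * a) ^ p * cis (2 * b) ^ q"
      using pq by simp
    also have "\<dots> = of_int m * cis (2 * (of_int i * a + of_int j * b)) * cis (2 * real d * (a + b))"
      by (simp add: Complex.DeMoivre cis_mult mult.assoc pq) (simp add: algebra_simps)
    finally show ?thesis using c[of a b]
      by (simp add: distrib_right sum.distrib)
  qed
  then show ?case by (intro exI[of _ ?c] allI)
qed

text \<open>The point (a0, b0) certifies that some coefficient is nonzero; it ranges over all real
  pairs, not only over angles of triangles. After the shift the degree in each variable is 2d, which
  explains the constants 48 and 4.\<close>

lemma emeasure_sublevel_trig_poly_int:
  assumes F: "trig_poly d F" and d: "1 \<le> d" and nz: "F a0 b0 \<noteq> 0" and \<eta>: "0 < \<eta>" "\<eta> \<le> 1"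
  shows "{x \<in> {0<..<pi} \<times> {0<..<pi}. norm (F (fst x) (snd x)) < \<eta>} \<in> sets lborel"
    and "emeasure lborel {x \<in> {0<..<pi} \<times> {0<..<pi}. norm (F (fst x) (snd x)) < \<eta>}
           \<le> ennreal (48 * pi * real d * \<eta> powr (1 / (4 * real d)))"
proof -
  obtain c :: "nat \<Rightarrow> nat \<Rightarrow> int" where c: "\<And>a b. F a b * cis (2 * real d * (a + b)) =
    (\<Sum>i\<le>2*d. \<Sum>j\<le>2*d. of_int (c i j) * cis (2 * a) ^ i * cis (2 * b) ^ j)"
    using trig_poly_coeffs[OF F] by blast
  have "\<exists>i\<le>2*d. \<exists>j\<le>2*d. c i j \<noteq> 0"
  proof (rule ccontr)
    assume "\<not> ?thesis"
    then have "F a0 b0 * cis (2 * real d * (a0 + b0)) = 0" unfolding c by simp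
    then show False using nz by simp
  qed
  note * = emeasure_sublevel_trig_poly2[OF this _ \<eta>]
  have n: "norm (F a b) = norm (\<Sum>i\<le>2*d. \<Sum>j\<le>2*d. of_int (c i j) * cis (2 * a) ^ i * cis (2 * b) ^ j)" for a b
    unfolding c[symmetric] by (simp add: norm_mult)
  have eq: "{x \<in> {0<..<pi} \<times> {0<..<pi}. norm (F (fst x) (snd x)) < \<eta>} = {x :: real \<times> real. fst x \<in> {0<..<pi} \<and> snd x \<in> {0<..<pi} \<and>
      norm (\<Sum>i\<le>2*d. \<Sum>j\<le>2*d. of_int (c i j) * cis (2 * fst x) ^ i * cis (2 * snd x) ^ j) < \<eta>}"
    unfolding n by (auto simp: mem_Times_iff)
  show "emeasure lborel {x \<in> {0<..<pi} \<times> {0<..<pi}. norm (F (fst x) (snd x)) < \<eta>}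
           \<le> ennreal (48 * pi * real d * \<eta> powr (1 / (4 * real d)))"
    unfolding eq using * d by (simp add: mult_ac)
  have "{x :: real \<times> real. fst x \<in> {0<..<pi} \<and> snd x \<in> {0<..<pi} \<and>
      norm (\<Sum>i\<le>2*d. \<Sum>j\<le>2*d. of_int (c i j) * cis (2 * fst x) ^ i * cis (2 * snd x) ^ j) < \<eta>}
      = {x \<in> space (borel :: (real \<times> real) measure). fst x \<in> {0<..<pi} \<and> snd x \<in> {0<..<pi} \<and>
      norm (\<Sum>i\<le>2*d. \<Sum>j\<le>2*d. of_int (c i j) * cis (2 * fst x) ^ i * cis (2 * snd x) ^ j) < \<eta>}"
    by simp
  also have "\<dots> \<in> sets borel"
    unfolding borel_prod[symmetric] by measurable
  finally show "{x \<in> {0<..<pi} \<times> {0<..<pi}. norm (F (fst x) (snd x)) < \<eta>} \<in> sets lborel"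
    unfolding eq by simp
qed

section \<open>Reflections in the sides and unfolded vertices\<close>

text \<open>Side \<open>s\<close> is the one opposite vertex \<open>s\<close>.\<close>

definition refl_side :: "real \<Rightarrow> real \<Rightarrow> nat \<Rightarrow> complex \<Rightarrow> complex" where
  "refl_side \<alpha> \<beta> s z =
     (if s = 0 then 1 + cis (- 2 * \<beta>) * cnj (z - 1) else if s = 1 then cis (2 * \<alpha>) * cnj z else cnj z)"

text \<open>The head of the word is the side crossed last: its reflection acts first, on the
  reference triangle, and the earlier crossings act afterwards. Following a trajectory therefore
  prepends letters, and a shared past factors out as one isometry applied last.\<close>

fun unfold_word :: "real \<Rightarrow> real \<Rightarrow> nat list \<Rightarrow> complex \<Rightarrow> complex" where
  "unfold_word \<alpha> \<beta> [] z = z"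
| "unfold_word \<alpha> \<beta> (s # w) z = unfold_word \<alpha> \<beta> w (refl_side \<alpha> \<beta> s z)"

lemma unfold_word_append:
  "unfold_word \<alpha> \<beta> (u @ w) z = unfold_word \<alpha> \<beta> w (unfold_word \<alpha> \<beta> u z)"
  by (induction u arbitrary: z) auto

text \<open>With the triangle scaled by \<open>cis (2 * (\<alpha> + \<beta>)) - 1\<close>, all unfolded vertices become
  integer trigonometric polynomials in the angles.\<close>

definition trig_rep :: "nat \<Rightarrow> (real \<Rightarrow> real \<Rightarrow> complex) \<Rightarrow> bool" where
  "trig_rep d P \<longleftrightarrow> (\<exists>F. trig_poly d F \<and>
     (\<forall>\<alpha> \<beta>. sin (\<alpha> + \<beta>) \<noteq> 0 \<longrightarrow> F \<alpha> \<beta> = (cis (2 * (\<alpha> + \<beta>)) - 1) * P \<alpha> \<beta>))"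

lemma cis_double_minus_1: "cis (2 * x) - 1 = 2 * \<i> * sin x * cis x"
  by (simp add: complex_eq_iff cos_double_sin sin_double power2_eq_square)

lemma trig_poly_scale: "trig_poly 1 (\<lambda>a b. cis (2 * (a + b)) - 1)"
  using trig_poly_diff[OF trig_poly_monom[of 1 1 1 1] trig_poly_monom[of 0 1 0 1]] by simp

text \<open>Only the third vertex has a denominator, and it equals e^(2ia) (e^(2ib) - 1) /
  (e^(2i(a+b)) - 1).\<close>

lemma trig_rep_vert: "trig_rep 1 (\<lambda>\<alpha> \<beta>. tri_vert \<alpha> \<beta> e)"
proof -
  consider "e = 0" | "e = 1" | "e \<noteq> 0" "e \<noteq> 1" by blast
  then show ?thesis
  proof cases
    case 1
    then show ?thesis unfolding trig_rep_def tri_vert_def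
      using trig_poly_0[of 1] by (intro exI[of _ "\<lambda>a b. 0"]) auto
  next
    case 2
    then show ?thesis unfolding trig_rep_def tri_vert_def
      using trig_poly_scale by (intro exI[of _ "\<lambda>a b. cis (2 * (a + b)) - 1"]) auto
  next
    case 3
    have "trig_poly 1 (\<lambda>a b. cis (2 * (a + b)) - cis (2 * a))"
      using trig_poly_diff[OF trig_poly_monom[of 1 1 1 1] trig_poly_monom[of 1 1 0 1]] by simp
    moreover have "cis (2 * (a + b)) - cis (2 * a) = (cis (2 * (a + b)) - 1) * tri_vert a b e"
      if "sin (a + b) \<noteq> 0" for a b
    proof -
      have "cis (2 * (a + b)) - cis (2 * a) = cis (2 * a) * (cis (2 * b) - 1)"
        by (simp add: cis_mult algebra_simps)
      also have "\<dots> = 2 * \<i> * sin b * (cis a * cis (a + b))"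
        unfolding cis_double_minus_1 by (simp add: cis_mult algebra_simps)
      also have "\<dots> = (cis (2 * (a + b)) - 1) * tri_vert a b e"
        unfolding cis_double_minus_1 using 3 that by (simp add: tri_vert_def)
      finally show ?thesis .
    qed
    ultimately show ?thesis unfolding trig_rep_def by blast
  qed
qed

text \<open>The scaling factor c = e^(2i(\<alpha>+\<beta>)) - 1 is not real, but its conjugate is
  -e^(-2i(\<alpha>+\<beta>)) c. Conjugation thus commutes with the scaling up to a monomial,
  recorded in \<open>cF\<close>, and a reflection raises the degree by at most 2.\<close>

lemma trig_rep_refl_side:
  assumes "trig_rep d P"
  shows "trig_rep (d + 2) (\<lambda>\<alpha> \<beta>. refl_side \<alpha> \<beta> s (P \<alpha> \<beta>))"
proof -
  obtain F where F: "trig_poly d F"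
    "\<And>\<alpha> \<beta>. sin (\<alpha> + \<beta>) \<noteq> 0 \<Longrightarrow> F \<alpha> \<beta> = (cis (2 * (\<alpha> + \<beta>)) - 1) * P \<alpha> \<beta>"
    using assms by (auto simp: trig_rep_def)
  have cF: "(cis (2 * (\<alpha> + \<beta>)) - 1) * cnj (P \<alpha> \<beta>) = - cis (2 * (\<alpha> + \<beta>)) * cnj (F \<alpha> \<beta>)"
    if "sin (\<alpha> + \<beta>) \<noteq> 0" for \<alpha> \<beta>
  proof -
    have "- cis (2 * (\<alpha> + \<beta>)) * (cnj (cis (2 * (\<alpha> + \<beta>))) - 1) = cis (2 * (\<alpha> + \<beta>)) - 1"
      by (simp add: cis_cnj cis_mult algebra_simps)
    then show ?thesis unfolding F(2)[OF that] by (metis complex_cnj_diff complex_cnj_mult complex_cnj_one mult.assoc)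
  qed
  note C = trig_poly_cnj[OF F(1)]
  consider "s = 0" | "s = 1" | "s \<noteq> 0" "s \<noteq> 1" by blast
  then show ?thesis
  proof cases
    case 1
    have "trig_poly (d + 2) (\<lambda>a b. (cis (2 * (a + b)) - 1) +
        (cis (2 * (0 * a + (-1) * b)) - cis (2 * (1 * a + 0 * b)) - cis (2 * (1 * a + 0 * b)) * cnj (F a b)))"
      using trig_poly_add[OF trig_poly_mono[OF trig_poly_scale, of "d + 2"]
          trig_poly_diff[OF trig_poly_diff[OF trig_poly_monom[of 0 "d + 2" "-1" 1]
            trig_poly_monom[of 1 "d + 2" 0 1]] trig_poly_shift[OF C, of 1 2 0 1]]]
      by simp
    moreover have "(cis (2 * (a + b)) - 1) +
        (cis (2 * (0 * a + (-1) * b)) - cis (2 * (1 * a + 0 * b)) - cis (2 * (1 * a + 0 * b)) * cnj (F a b))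
        = (cis (2 * (a + b)) - 1) * refl_side a b s (P a b)" if "sin (a + b) \<noteq> 0" for a b
    proof -
      have "(cis (2 * (a + b)) - 1) * refl_side a b s (P a b)
        = (cis (2 * (a + b)) - 1) + cis (- 2 * b) * ((cis (2 * (a + b)) - 1) * cnj (P a b))
           - cis (- 2 * b) * (cis (2 * (a + b)) - 1)"
        using 1 by (simp add: refl_side_def algebra_simps)
      also have "cis (- 2 * b) * ((cis (2 * (a + b)) - 1) * cnj (P a b)) = - (cis (- 2 * b) * cis (2 * (a + b))) * cnj (F a b)"
        unfolding cF[OF that] by simp
      also have "cis (- 2 * b) * cis (2 * (a + b)) = cis (2 * a)"
        by (simp add: cis_mult)
      also have "cis (- 2 * b) * (cis (2 * (a + b)) - 1) = cis (2 * a) - cis (- 2 * b)"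
        by (simp add: cis_mult right_diff_distrib)
      finally show ?thesis by (simp add: algebra_simps)
    qed
    ultimately show ?thesis unfolding trig_rep_def by blast
  next
    case 2
    have "trig_poly (d + 2) (\<lambda>a b. of_int (-1) * cis (2 * (of_int 2 * a + of_int 1 * b)) * cnj (F a b))"
      by (rule trig_poly_shift[OF C]) auto
    moreover have "of_int (-1) * cis (2 * (of_int 2 * a + of_int 1 * b)) * cnj (F a b)
        = (cis (2 * (a + b)) - 1) * refl_side a b s (P a b)" if "sin (a + b) \<noteq> 0" for a b
    proof -
      have "(cis (2 * (a + b)) - 1) * refl_side a b s (P a b)
         = cis (2 * a) * ((cis (2 * (a + b)) - 1) * cnj (P a b))"
        using 2 by (simp add: refl_side_def)
      also have "\<dots> = - (cis (2 * a) * cis (2 * (a + b))) * cnj (F a b)"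
        unfolding cF[OF that] by simp
      also have "cis (2 * a) * cis (2 * (a + b)) = cis (2 * (2 * a + b))"
        by (simp add: cis_mult algebra_simps)
      finally show ?thesis by simp
    qed
    ultimately show ?thesis unfolding trig_rep_def by blast
  next
    case 3
    have "trig_poly (d + 2) (\<lambda>a b. of_int (-1) * cis (2 * (of_int 1 * a + of_int 1 * b)) * cnj (F a b))"
      by (rule trig_poly_shift[OF C]) auto
    moreover have "of_int (-1) * cis (2 * (of_int 1 * a + of_int 1 * b)) * cnj (F a b)
        = (cis (2 * (a + b)) - 1) * refl_side a b s (P a b)" if "sin (a + b) \<noteq> 0" for a b
      using cF[OF that] 3 by (simp add: refl_side_def)
    ultimately show ?thesis unfolding trig_rep_def by blast
  qed
qed

lemma trig_rep_unfold_word: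
  "trig_rep d P \<Longrightarrow> trig_rep (d + 2 * length w) (\<lambda>\<alpha> \<beta>. unfold_word \<alpha> \<beta> w (P \<alpha> \<beta>))"
proof (induction w arbitrary: d P)
  case (Cons s w)
  then show ?case
    using Cons.IH[OF trig_rep_refl_side[OF Cons.prems, of s]] by (simp add: add_ac)
qed simp

lemma trig_rep_mono: "trig_rep d P \<Longrightarrow> d \<le> e \<Longrightarrow> trig_rep e P"
  unfolding trig_rep_def using trig_poly_mono by blast

text \<open>The orientation is an imaginary part. Using \<open>W - cnj W\<close>, which is 2i times
  the imaginary part, keeps the coefficients integral and causes the factor 2; the scaling enters
  once through each of the two differences, hence squared.\<close>

lemma trig_poly_orient:
  assumes "trig_rep d P" "trig_rep d Q" "trig_rep d S"
  shows "\<exists>G. trig_poly (d + d) G \<and> (\<forall>\<alpha> \<beta>. sin (\<alpha> + \<beta>) \<noteq> 0 \<longrightarrow>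
    norm (G \<alpha> \<beta>) = 2 * (norm (cis (2 * (\<alpha> + \<beta>)) - 1))\<^sup>2 * \<bar>orient (P \<alpha> \<beta>) (Q \<alpha> \<beta>) (S \<alpha> \<beta>)\<bar>)"
proof -
  let ?c = "\<lambda>\<alpha> \<beta>. cis (2 * (\<alpha> + \<beta>)) - 1"
  obtain F G H where F: "trig_poly d F" "\<And>\<alpha> \<beta>. sin (\<alpha> + \<beta>) \<noteq> 0 \<Longrightarrow> F \<alpha> \<beta> = ?c \<alpha> \<beta> * P \<alpha> \<beta>"
    and G: "trig_poly d G" "\<And>\<alpha> \<beta>. sin (\<alpha> + \<beta>) \<noteq> 0 \<Longrightarrow> G \<alpha> \<beta> = ?c \<alpha> \<beta> * Q \<alpha> \<beta>"
    and H: "trig_poly d H" "\<And>\<alpha> \<beta>. sin (\<alpha> + \<beta>) \<noteq> 0 \<Longrightarrow> H \<alpha> \<beta> = ?c \<alpha> \<beta> * S \<alpha> \<beta>"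
    using assms unfolding trig_rep_def by metis
  define W where "W = (\<lambda>\<alpha> \<beta>. cnj (G \<alpha> \<beta> - F \<alpha> \<beta>) * (H \<alpha> \<beta> - F \<alpha> \<beta>))"
  have W: "trig_poly (d + d) W" unfolding W_def
    by (intro trig_poly_mult trig_poly_cnj trig_poly_diff F G H)
  have "trig_poly (d + d) (\<lambda>\<alpha> \<beta>. W \<alpha> \<beta> - cnj (W \<alpha> \<beta>))"
    by (intro trig_poly_diff trig_poly_cnj W)
  moreover have "norm (W \<alpha> \<beta> - cnj (W \<alpha> \<beta>)) =
      2 * (norm (?c \<alpha> \<beta>))\<^sup>2 * \<bar>orient (P \<alpha> \<beta>) (Q \<alpha> \<beta>) (S \<alpha> \<beta>)\<bar>" if "sin (\<alpha> + \<beta>) \<noteq> 0" for \<alpha> \<beta>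
  proof -
    have "W \<alpha> \<beta> = (cnj (?c \<alpha> \<beta>) * ?c \<alpha> \<beta>) * (cnj (Q \<alpha> \<beta> - P \<alpha> \<beta>) * (S \<alpha> \<beta> - P \<alpha> \<beta>))"
      unfolding W_def F(2)[OF that] G(2)[OF that] H(2)[OF that] by (simp add: algebra_simps)
    also have "cnj (?c \<alpha> \<beta>) * ?c \<alpha> \<beta> = of_real ((norm (?c \<alpha> \<beta>))\<^sup>2)"
      by (metis complex_norm_square mult.commute)
    finally have "Im (W \<alpha> \<beta>) = (norm (?c \<alpha> \<beta>))\<^sup>2 * orient (P \<alpha> \<beta>) (Q \<alpha> \<beta>) (S \<alpha> \<beta>)"
      by (simp only: Im_complex_of_real Re_complex_of_real times_complex.simps orient_def cr_def)
    moreover have "norm (W \<alpha> \<beta> - cnj (W \<alpha> \<beta>)) = 2 * \<bar>Im (W \<alpha> \<beta>)\<bar>"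
      by (simp add: complex_diff_cnj norm_mult)
    ultimately show ?thesis by (simp add: abs_mult)
  qed
  ultimately show ?thesis by blast
qed

section \<open>Splitting of beams\<close>

locale triangle =
  fixes \<alpha> \<beta> :: real
  assumes angles: "0 < \<alpha>" "0 < \<beta>" "\<alpha> + \<beta> < pi"
begin

abbreviation "V \<equiv> tri_vert \<alpha> \<beta>"
abbreviation "R \<equiv> refl_side \<alpha> \<beta>"
abbreviation "W \<equiv> unfold_word \<alpha> \<beta>"

lemma sin_pos: "0 < sin \<alpha>" "0 < sin \<beta>" "0 < sin (\<alpha> + \<beta>)"
  using angles by (auto intro!: sin_gt_zero)

lemma V2_minus_V1: "V 2 - V 1 = - of_real (sin \<alpha> / sin (\<alpha> + \<beta>)) * cis (- \<beta>)"
proof -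
  have "sin (\<alpha> + \<beta>) * (sin \<beta> / sin (\<alpha> + \<beta>) * cos \<alpha> - 1) = sin \<beta> * cos \<alpha> - sin (\<alpha> + \<beta>)"
    using sin_pos by (simp add: right_diff_distrib)
  also have "\<dots> = - (sin \<alpha> * cos \<beta>)" by (simp add: sin_add)
  finally have "sin \<beta> / sin (\<alpha> + \<beta>) * cos \<alpha> - 1 = - (sin \<alpha> / sin (\<alpha> + \<beta>)) * cos \<beta>"
    using sin_pos by (simp add: field_simps)
  then show ?thesis by (simp add: tri_vert_def complex_eq_iff)
qed

definition refl_dir :: "nat \<Rightarrow> complex" where
  "refl_dir s = (if s = 0 then cis (- 2 * \<beta>) else if s = 1 then cis (2 * \<alpha>) else 1)"

lemma norm_refl_dir [simp]: "norm (refl_dir s) = 1"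
  by (simp add: refl_dir_def)

lemma R_diff: "R s p - R s q = refl_dir s * cnj (p - q)"
  by (simp add: refl_side_def refl_dir_def algebra_simps)

lemma less_3_cases: "i < 3 \<longleftrightarrow> i = 0 \<or> i = 1 \<or> i = (2::nat)"
  by auto

lemma R_V:
  assumes "i < 3" "s < 3" "i \<noteq> s"
  shows "R s (V i) = V i"
proof -
  have "cis (2 * \<alpha>) * cnj (V 2) = V 2"
    by (simp add: tri_vert_def cis_cnj cis_mult)
  moreover have "1 + cis (- 2 * \<beta>) * cnj (V 2 - V 1) = 1 + (V 2 - V 1)"
    unfolding V2_minus_V1 by (simp add: cis_cnj cis_mult)
  moreover have "V 1 = 1" by (simp add: tri_vert_def)
  ultimately show ?thesis using assms unfolding less_3_cases
    by (auto simp: refl_side_def) (auto simp: tri_vert_def)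
qed

lemma orient_R: "orient (R s p) (R s q) (R s t) = - orient p q t"
proof -
  have "cnj (refl_dir s) * refl_dir s = 1"
    by (metis complex_norm_square mult.commute norm_refl_dir of_real_1 power_one)
  then have "cnj (refl_dir s * cnj (q - p)) * (refl_dir s * cnj (t - p)) = (q - p) * cnj (t - p)"
    by (metis complex_cnj_cnj complex_cnj_mult mult.assoc mult.left_commute mult_1)
  then have "orient (R s p) (R s q) (R s t) = Im ((q - p) * cnj (t - p))"
    unfolding orient_def R_diff cr_def by (simp only:)
  also have "\<dots> = - orient p q t" by (simp add: orient_def cr_alt algebra_simps)
  finally show ?thesis .
qed

lemma norm_W: "norm (W w p - W w q) = norm (p - q)"
  by (induction w arbitrary: p q) (auto simp: R_diff norm_mult simp flip: complex_cnj_diff)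

lemma orient_W: "orient (W w p) (W w q) (W w t) = (- 1) ^ length w * orient p q t"
  by (induction w arbitrary: p q t) (auto simp: orient_R)

lemma W_diff_scale:
  "p - q = of_real c * (p' - q') \<Longrightarrow> W w p - W w q = of_real c * (W w p' - W w q')"
proof (induction w arbitrary: p q p' q')
  case (Cons s w)
  have "R s p - R s q = of_real c * (R s p' - R s q')"
    unfolding R_diff Cons.prems by simp
  then show ?case using Cons.IH by simp
qed simp

lemma orient_V:
  assumes "i < 3"
  shows "0 < orient (V i) (V ((i + 1) mod 3)) (V ((i + 2) mod 3))"
proof -
  have "orient (V 0) (V 1) (V 2) > 0"
    using sin_pos by (simp add: orient_def cr_alt tri_vert_def)
  moreover have "orient (V 2) (V 0) (V 1) = orient (V 0) (V 1) (V 2)" "orient (V 1) (V 2) (V 0) = orient (V 0) (V 1) (V 2)"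
    by (simp_all add: orient_def cr_alt algebra_simps)
  ultimately have *: "0 < orient (V 0) (V 1) (V 2)" "0 < orient (V 1) (V 2) (V 0)" "0 < orient (V 2) (V 0) (V 1)"
    by (simp_all only:)
  have "(0 + 1) mod 3 = (1::nat)" "(0 + 2) mod 3 = (2::nat)" "(1 + 1) mod 3 = (2::nat)"
    "(1 + 2) mod 3 = (0::nat)" "(2 + 1) mod 3 = (0::nat)" "(2 + 2) mod 3 = (1::nat)"
    by simp_all
  note m = this
  have "i = 0 \<or> i = 1 \<or> i = 2" using assms by linarith
  then show ?thesis
    by (elim disjE) (simp_all only: m *)
qed

end

text \<open>Position of a beam of trajectories issued from a vertex, after it has crossed the sides listed in
  \<open>word\<close>: \<open>lab_l\<close>, \<open>lab_r\<close> label the left and right endpoint of the last side crossed,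
  \<open>lab_a\<close> the opposite vertex of the triangle being entered, and the beam is the open cone bounded by
  the rays through the (unfolded) points \<open>bd_l\<close> and \<open>bd_r\<close>.\<close>

datatype state = State (word: "nat list") (lab_l: nat) (lab_r: nat) (lab_a: nat) (bd_l: complex) (bd_r: complex)

section \<open>The tree of beams issued from one vertex\<close>

locale pointed_triangle = triangle +
  fixes v :: nat
  assumes v_less_3: "v < 3"
begin

definition base :: complex where "base = V v"

definition apex :: "state \<Rightarrow> complex" where
  "apex T = W (word T) (V (lab_a T))"

definition splits :: "state \<Rightarrow> bool" where
  "splits T \<longleftrightarrow> sbetween (bd_r T - base) (apex T - base) (bd_l T - base)"

text \<open>A vertex strictly inside the cone splits the beam and bounds both parts. Otherwise the
  beam passes on one side of it: if the apex is on or to the right of the right ray, the side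
  joining \<open>i\<close> and \<open>e\<close> is crossed, which is the side opposite
  \<open>j\<close> and so has the letter \<open>j\<close>.\<close>

definition children :: "state \<Rightarrow> state list" where
  "children T = (case T of State w i j e l r \<Rightarrow>
     if splits T then [State (j # w) i e j l (apex T), State (i # w) e j i (apex T) r]
     else if cr (r - base) (apex T - base) \<le> 0 then [State (j # w) i e j l r]
     else [State (i # w) e j i l r])"

fun descendants :: "nat \<Rightarrow> state \<Rightarrow> state list" where
  "descendants 0 T = [T]"
| "descendants (Suc n) T = concat (map (descendants n) (children T))"

definition valid :: "state \<Rightarrow> bool" where
  "valid T \<longleftrightarrow> lab_l T < 3 \<and> lab_r T < 3 \<and> lab_a T < 3 \<and> distinct [lab_l T, lab_r T, lab_a T] \<and>
     beam (W (word T) (V (lab_l T)) - base) (W (word T) (V (lab_r T)) - base) (apex T - base)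
       (bd_l T - base) (bd_r T - base)"

lemma children_cases:
  assumes "T' \<in> set (children T)"
  obtains (split_l) w i j e l r where "T = State w i j e l r" "splits T" "T' = State (j # w) i e j l (apex T)"
  | (split_r) w i j e l r where "T = State w i j e l r" "splits T" "T' = State (i # w) e j i (apex T) r"
  | (left) w i j e l r where "T = State w i j e l r" "\<not> splits T" "cr (r - base) (apex T - base) \<le> 0"
      "T' = State (j # w) i e j l r"
  | (right) w i j e l r where "T = State w i j e l r" "\<not> splits T" "cr (apex T - base) (l - base) \<le> 0"
      "T' = State (i # w) e j i l r"
proof -
  obtain w i j e l r where T: "T = State w i j e l r" by (cases T)
  show thesis
  proof (cases "splits T")
    case True
    then have "T' = State (j # w) i e j l (apex T) \<or> T' = State (i # w) e j i (apex T) r"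
      using assms by (simp add: T children_def)
    then show thesis using split_l[OF T True] split_r[OF T True] by blast
  next
    case False
    show thesis
    proof (cases "cr (r - base) (apex T - base) \<le> 0")
      case le: True
      then have "T' = State (j # w) i e j l r" using assms False by (simp add: T children_def)
      then show thesis using left[OF T False le] by blast
    next
      case gt: False
      then have "T' = State (i # w) e j i l r" using assms False by (simp add: T children_def)
      moreover have "cr (apex T - base) (l - base) \<le> 0"
        using False gt T by (simp add: splits_def sbetween_def)
      ultimately show thesis using right[OF T False] by blast
    qed
  qed
qed

lemma children_splits:
  assumes "splits T"
  obtains T1 T2 where "children T = [T1, T2]" "bd_l T1 = bd_l T" "bd_r T1 = apex T"
      "bd_l T2 = apex T" "bd_r T2 = bd_r T"
  using assms that by (cases T) (simp add: children_def)

lemma children_not_splits: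
  assumes "\<not> splits T"
  obtains T' where "children T = [T']" "bd_l T' = bd_l T" "bd_r T' = bd_r T"
  using assms that by (cases T; cases "cr (bd_r T - base) (apex T - base) \<le> 0") (simp_all add: children_def)

text \<open>Reflection reverses orientation, and so does the exchange of two arguments. In a beam
  the right-hand side is negative, so the new vertex is beyond the side just crossed, as
  \<open>beam_left\<close> and \<open>beam_split_left\<close> demand of their last
  hypothesis.\<close>

lemma orient_new_left:
  assumes "i < 3" "j < 3" "e < 3" "distinct [i, j, e]"
  shows "orient (W (j # w) (V j)) (W w (V e)) (W w (V i)) = orient (W w (V e)) (W w (V j)) (W w (V i))"
proof -
  have "orient (W (j # w) (V j)) (W (j # w) (V e)) (W (j # w) (V i)) = orient (W w (V e)) (W w (V j)) (W w (V i))"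
    by (simp add: orient_W orient_R) (simp add: orient_def cr_alt algebra_simps)
  then show ?thesis using assms by (auto simp: R_V)
qed

lemma orient_new_right:
  assumes "i < 3" "j < 3" "e < 3" "distinct [i, j, e]"
  shows "orient (W (i # w) (V i)) (W w (V j)) (W w (V e)) = orient (W w (V e)) (W w (V j)) (W w (V i))"
proof -
  have "orient (W (i # w) (V i)) (W (i # w) (V j)) (W (i # w) (V e)) = orient (W w (V e)) (W w (V j)) (W w (V i))"
    by (simp add: orient_W orient_R) (simp add: orient_def cr_alt algebra_simps)
  then show ?thesis using assms by (auto simp: R_V)
qed

lemma valid_children:
  assumes T: "valid T" and T': "T' \<in> set (children T)"
  shows "valid T'"
  using T'
proof (cases rule: children_cases)
  case (split_l w i j e l r)
  have lab: "i < 3" "j < 3" "e < 3" "distinct [i, j, e]" and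
    B: "beam (W w (V i) - base) (W w (V j) - base) (W w (V e) - base) (l - base) (r - base)"
    using T split_l by (auto simp: valid_def apex_def)
  have "beam (W w (V i) - base) (W w (V e) - base) (W (j # w) (V j) - base) (l - base) (W w (V e) - base)"
    using B split_l orient_new_left[OF lab, of w]
    by (intro beam_split_left[OF B]) (auto simp: splits_def apex_def orient_translate beam_def)
  then show ?thesis using split_l lab by (auto simp: valid_def apex_def R_V)
next
  case (split_r w i j e l r)
  have lab: "i < 3" "j < 3" "e < 3" "distinct [i, j, e]" and
    B: "beam (W w (V i) - base) (W w (V j) - base) (W w (V e) - base) (l - base) (r - base)"
    using T split_r by (auto simp: valid_def apex_def)
  have "beam (W w (V e) - base) (W w (V j) - base) (W (i # w) (V i) - base) (W w (V e) - base) (r - base)"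
    using B split_r orient_new_right[OF lab, of w]
    by (intro beam_split_right[OF B]) (auto simp: splits_def apex_def orient_translate beam_def)
  then show ?thesis using split_r lab by (auto simp: valid_def apex_def R_V)
next
  case (left w i j e l r)
  have lab: "i < 3" "j < 3" "e < 3" "distinct [i, j, e]" and
    B: "beam (W w (V i) - base) (W w (V j) - base) (W w (V e) - base) (l - base) (r - base)"
    using T left by (auto simp: valid_def apex_def)
  have "beam (W w (V i) - base) (W w (V e) - base) (W (j # w) (V j) - base) (l - base) (r - base)"
    using B left orient_new_left[OF lab, of w]
    by (intro beam_left[OF B]) (auto simp: apex_def orient_translate beam_def)
  then show ?thesis using left lab by (auto simp: valid_def apex_def R_V)
next
  case (right w i j e l r)
  have lab: "i < 3" "j < 3" "e < 3" "distinct [i, j, e]" and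
    B: "beam (W w (V i) - base) (W w (V j) - base) (W w (V e) - base) (l - base) (r - base)"
    using T right by (auto simp: valid_def apex_def)
  have "beam (W w (V e) - base) (W w (V j) - base) (W (i # w) (V i) - base) (l - base) (r - base)"
    using B right orient_new_right[OF lab, of w]
    by (intro beam_right[OF B]) (auto simp: apex_def orient_translate beam_def)
  then show ?thesis using right lab by (auto simp: valid_def apex_def R_V)
qed

lemma concat_map_concat: "concat (map f (concat xss)) = concat (map (\<lambda>xs. concat (map f xs)) xss)"
  by (induction xss) auto

lemma descendants_add: "descendants (m + k) T = concat (map (descendants k) (descendants m T))"
proof (induction m arbitrary: T)
  case (Suc m)
  have "descendants (m + k) = (\<lambda>T. concat (map (descendants k) (descendants m T)))"
    by (rule ext) (rule Suc)
  then show ?case by (simp add: concat_map_concat o_def)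
qed simp

lemma valid_descendants: "valid T \<Longrightarrow> T' \<in> set (descendants n T) \<Longrightarrow> valid T'"
  by (induction n arbitrary: T) (auto dest: valid_children)

lemma word_children:
  "valid T \<Longrightarrow> T' \<in> set (children T) \<Longrightarrow> \<exists>s<3. word T' = s # word T"
  by (elim children_cases) (auto simp: valid_def)

lemma word_descendants:
  "valid T \<Longrightarrow> T' \<in> set (descendants n T) \<Longrightarrow>
     \<exists>u. word T' = u @ word T \<and> length u = n \<and> set u \<subseteq> {..<3}"
proof (induction n arbitrary: T)
  case (Suc n)
  then obtain T1 where T1: "T1 \<in> set (children T)" "T' \<in> set (descendants n T1)" by auto
  then obtain u where "word T' = u @ word T1" "length u = n" "set u \<subseteq> {..<3}"
    using Suc valid_children by metis
  moreover obtain s where "s < 3" "word T1 = s # word T"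
    using word_children Suc.prems(1) T1(1) by blast
  ultimately show ?case by (intro exI[of _ "u @ [s]"]) auto
qed simp

section \<open>Linear growth when the splitting vertices are collinear\<close>

definition split_points :: "state \<Rightarrow> nat \<Rightarrow> complex set" where
  "split_points T k = {apex T' | T' i. i < k \<and> T' \<in> set (descendants i T) \<and> splits T'}"

lemma split_points_child:
  "T' \<in> set (children T) \<Longrightarrow> split_points T' k \<subseteq> split_points T (Suc k)"
  unfolding split_points_def by (fastforce intro: exI[of _ "Suc _"])

lemma apex_split_point: "splits T \<Longrightarrow> apex T \<in> split_points T (Suc k)"
  unfolding split_points_def by (force intro!: exI[of _ T] exI[of _ 0])

definition collinear_set :: "complex set \<Rightarrow> bool" where
  "collinear_set X \<longleftrightarrow> (\<forall>A\<in>X. \<forall>B\<in>X. \<forall>C\<in>X. orient A B C = 0)"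

text \<open>The bounding points come from splittings of ancestors and need not be among the
  splitting points of \<open>T\<close>; a fixed set \<open>X\<close> containing both kinds survives
  the induction. A splitting would put both bounds and the apex on one line, against
  \<open>beam_not_collinear\<close>.\<close>

lemma beam_closed_count:
  assumes "valid T" "bd_l T \<in> X" "bd_r T \<in> X" "split_points T k \<subseteq> X" "collinear_set X"
  shows "length (descendants k T) = 1"
  using assms
proof (induction k arbitrary: T)
  case (Suc k)
  have ns: "\<not> splits T"
  proof
    assume s: "splits T"
    then have "apex T \<in> X" using apex_split_point Suc.prems by blast
    then have "orient (bd_r T) (apex T) (bd_l T) = 0"
      using Suc.prems by (auto simp: collinear_set_def)
    then have "orient (bd_r T - base) (apex T - base) (bd_l T - base) = 0"
      by (simp add: orient_translate)
    then show False using beam_not_collinear s Suc.prems(1) unfolding valid_def splits_def by blast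
  qed
  then obtain T' where T': "children T = [T']" "bd_l T' = bd_l T" "bd_r T' = bd_r T"
    by (rule children_not_splits)
  have "length (descendants k T') = 1"
    by (rule Suc.IH) (use T' Suc.prems valid_children split_points_child[of T' T k] in auto)
  then show ?case using T' by simp
qed simp

text \<open>At a split the apex, which is in \<open>X\<close>, bounds both parts. The part next to
  the old bound in \<open>X\<close> then has both bounds in \<open>X\<close> and stays single; the
  other is again of the present kind. Each generation adds at most one beam.\<close>

lemma beam_half_count:
  assumes "valid T" "bd_l T \<in> X \<or> bd_r T \<in> X" "split_points T k \<subseteq> X" "collinear_set X"
  shows "length (descendants k T) \<le> Suc k"
  using assms
proof (induction k arbitrary: T)
  case (Suc k)
  show ?case
  proof (cases "splits T")
    case True
    then obtain T1 T2 where ch: "children T = [T1, T2]" "bd_l T1 = bd_l T" "bd_r T1 = apex T"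
      "bd_l T2 = apex T" "bd_r T2 = bd_r T"
      by (rule children_splits)
    have a: "apex T \<in> X" using apex_split_point True Suc.prems by blast
    have v: "valid T1" "valid T2" "split_points T1 k \<subseteq> X" "split_points T2 k \<subseteq> X"
      using ch Suc.prems valid_children split_points_child[of T1 T k] split_points_child[of T2 T k] by auto
    have "length (descendants k T1) \<le> Suc k" "length (descendants k T2) \<le> Suc k"
      using v ch a Suc.prems by (auto intro!: Suc.IH simp del: descendants.simps)
    moreover have "length (descendants k T1) = 1 \<or> length (descendants k T2) = 1"
      using Suc.prems(2)
    proof
      assume "bd_l T \<in> X"
      then show ?thesis using beam_closed_count[of T1 X k] v ch a Suc.prems by auto
    next
      assume "bd_r T \<in> X"
      then show ?thesis using beam_closed_count[of T2 X k] v ch a Suc.prems by auto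
    qed
    ultimately show ?thesis using ch by auto
  next
    case False
    then obtain T' where T': "children T = [T']" "bd_l T' = bd_l T" "bd_r T' = bd_r T"
      by (rule children_not_splits)
    have "length (descendants k T') \<le> Suc k"
      by (rule Suc.IH) (use T' Suc.prems valid_children split_points_child[of T' T k] in auto)
    then show ?thesis using T' by simp
  qed
qed simp

text \<open>Before its first split the beam is single. Afterwards both parts have the apex as one
  bound, so \<open>beam_half_count\<close> applies to each of them.\<close>

lemma beam_count:
  assumes "valid T" "collinear_set (split_points T k)"
  shows "length (descendants k T) \<le> 2 * k + 1"
proof -
  have "length (descendants k T) \<le> 2 * k + 1" if "split_points T k \<subseteq> X" "collinear_set X" "valid T" for X
    using that
  proof (induction k arbitrary: T)
    case (Suc k)
    show ?case
    proof (cases "splits T")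
      case True
      then obtain T1 T2 where ch: "children T = [T1, T2]" "bd_r T1 = apex T" "bd_l T2 = apex T"
        by (rule children_splits)
      have a: "apex T \<in> X" using apex_split_point True Suc.prems by blast
      have v: "valid T1" "valid T2" "split_points T1 k \<subseteq> X" "split_points T2 k \<subseteq> X"
        using ch Suc.prems valid_children split_points_child[of T1 T k] split_points_child[of T2 T k] by auto
      have "length (descendants k T1) \<le> Suc k" "length (descendants k T2) \<le> Suc k"
        using beam_half_count[of T1 X k] beam_half_count[of T2 X k] v ch a Suc.prems by auto
      then show ?thesis using ch by auto
    next
      case False
      then obtain T' where T': "children T = [T']"
        by (rule children_not_splits)
      have "length (descendants k T') \<le> 2 * k + 1"
        by (rule Suc.IH) (use T' Suc.prems valid_children split_points_child[of T' T k] in auto)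
      then show ?thesis using T' by simp
    qed
  qed simp
  then show ?thesis using assms by blast
qed

lemma length_descendants_le: "length (descendants k T) \<le> 2 ^ k"
proof (induction k arbitrary: T)
  case (Suc k)
  have "length (children T) \<le> 2" by (cases T) (simp add: children_def)
  have "length (descendants (Suc k) T) \<le> (\<Sum>t\<leftarrow>children T. 2 ^ k)"
    using Suc by (simp add: length_concat o_def sum_list_mono)
  also have "\<dots> = length (children T) * 2 ^ k" by (simp add: sum_list_triv)
  also have "\<dots> \<le> 2 * 2 ^ k" using \<open>length (children T) \<le> 2\<close> by (intro mult_right_mono) auto
  finally show ?case by simp
qed simp

text \<open>Every beam has a child, so generations never shrink. This allows rounding
  \<open>n\<close> up to a multiple of \<open>k\<close> and bounding all earlier generations by the
  last one.\<close>

lemma length_descendants_mono: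
  assumes "m \<le> n" shows "length (descendants m T) \<le> length (descendants n T)"
proof -
  have 1: "1 \<le> length (descendants k S)" for k S
  proof (induction k arbitrary: S)
    case (Suc k)
    obtain S' ss where "children S = S' # ss"
      by (metis children_splits children_not_splits)
    then show ?case using Suc[of S'] by simp
  qed simp
  have "length (descendants m T) = (\<Sum>t\<leftarrow>descendants m T. 1)" by (simp add: sum_list_triv)
  also have "\<dots> \<le> (\<Sum>t\<leftarrow>descendants m T. length (descendants (n - m) t))"
    by (intro sum_list_mono 1)
  also have "\<dots> = length (descendants (m + (n - m)) T)"
    unfolding descendants_add by (simp add: length_concat o_def)
  finally show ?thesis using assms by simp
qed

end

section \<open>Thin beams\<close>

text \<open>Neither the source vertex nor the past of the beam enters, only words of length at most
  \<open>k\<close>. Exact zero is allowed because some triples are collinear in every triangle, for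
  instance those with a repeated point.\<close>

definition separated :: "real \<Rightarrow> real \<Rightarrow> nat \<Rightarrow> real \<Rightarrow> bool" where
  "separated \<alpha> \<beta> k \<eta> \<longleftrightarrow> (\<forall>u1 u2 u3 e1 e2 e3. length u1 \<le> k \<and> length u2 \<le> k \<and> length u3 \<le> k \<and>
      set u1 \<subseteq> {..<3} \<and> set u2 \<subseteq> {..<3} \<and> set u3 \<subseteq> {..<3} \<and> e1 < 3 \<and> e2 < 3 \<and> e3 < 3 \<longrightarrow>
      orient (unfold_word \<alpha> \<beta> u1 (tri_vert \<alpha> \<beta> e1)) (unfold_word \<alpha> \<beta> u2 (tri_vert \<alpha> \<beta> e2))
        (unfold_word \<alpha> \<beta> u3 (tri_vert \<alpha> \<beta> e3)) = 0 \<or>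
      \<eta> \<le> \<bar>orient (unfold_word \<alpha> \<beta> u1 (tri_vert \<alpha> \<beta> e1)) (unfold_word \<alpha> \<beta> u2 (tri_vert \<alpha> \<beta> e2))
        (unfold_word \<alpha> \<beta> u3 (tri_vert \<alpha> \<beta> e3))\<bar>)"

context pointed_triangle
begin

definition end_l :: nat where "end_l = (v + 2) mod 3"
definition end_r :: nat where "end_r = (v + 1) mod 3"

text \<open>The full angle at \<open>v\<close>, just after the opposite side has been crossed. The
  vertices are numbered counterclockwise, so seen from \<open>v\<close> the next one is the right
  endpoint and the one after it the left endpoint.\<close>

definition start :: state where
  "start = State [v] end_l end_r v (V end_l) (V end_r)"

definition x0 :: complex where "x0 = V end_l - base"
definition y0 :: complex where "y0 = V end_r - base"

lemma end_props: "end_l < 3" "end_r < 3" "distinct [end_l, end_r, v]"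
proof -
  have "(v + 2) mod 3 \<noteq> (v + 1) mod 3" "(v + 2) mod 3 \<noteq> v" "(v + 1) mod 3 \<noteq> v"
    using v_less_3 by presburger+
  then show "distinct [end_l, end_r, v]" by (simp only: end_l_def end_r_def distinct.simps) auto
qed (simp_all only: end_l_def end_r_def mod_less_divisor zero_less_numeral)

lemma cr_y0_x0: "0 < cr y0 x0"
  using orient_V[OF v_less_3] by (simp add: orient_def x0_def y0_def base_def end_l_def end_r_def)

lemma valid_start: "valid start"
proof -
  have 1: "R v (V end_l) = V end_l" "R v (V end_r) = V end_r"
    using end_props v_less_3 by (auto intro!: R_V)
  have "orient (R v (V v)) (V end_r) (V end_l) < 0"
    using orient_R[of v "V v" "V end_r" "V end_l"] cr_y0_x0 unfolding 1
    by (simp add: orient_def x0_def y0_def base_def)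
  then have "beam (V end_l - base) (V end_r - base) (R v (V v) - base) (V end_l - base) (V end_r - base)"
    using cr_y0_x0 unfolding beam_def orient_translate by (simp add: x0_def y0_def) (simp add: orient_alt)
  then show ?thesis using end_props v_less_3 1 by (auto simp: valid_def start_def apex_def)
qed

section \<open>The width of a beam in a projective coordinate\<close>

text \<open>This is the linear functional \<open>cr (y0 - x0) p\<close>, proportional to the signed
  distance from the line through the source parallel to the opposite side. It is the denominator of
  the projective coordinate \<open>slope\<close>.\<close>

definition weight :: "complex \<Rightarrow> real" where
  "weight p = cr y0 p + cr p x0"

text \<open>Projective coordinate of the direction of \<open>p\<close>, running from 0 at \<open>y0\<close> to 1 at \<open>x0\<close>.\<close>

definition slope :: "complex \<Rightarrow> real" where
  "slope p = cr y0 p / weight p"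

definition in_sector :: "complex \<Rightarrow> bool" where
  "in_sector p \<longleftrightarrow> 0 \<le> cr y0 p \<and> 0 \<le> cr p x0 \<and> 0 < weight p"

text \<open>An instance of the Pluecker relation. It turns closeness of directions into smallness of
  areas, and signs of \<open>cr\<close> into the order of slopes, without any trigonometry.\<close>

lemma cr_slope:
  assumes "in_sector p" "in_sector q"
  shows "cr p q * cr y0 x0 = weight p * weight q * (slope q - slope p)"
proof -
  have "weight p * weight q * (slope q - slope p) = weight p * cr y0 q - weight q * cr y0 p"
    using assms by (simp add: slope_def in_sector_def right_diff_distrib)
  also have "\<dots> = cr p q * cr y0 x0"
    using cr_plucker[of p q y0 x0] by (simp add: weight_def algebra_simps)
  finally show ?thesis by simp
qed

lemma slope_less_iff:
  assumes "in_sector p" "in_sector q"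
  shows "slope p < slope q \<longleftrightarrow> 0 < cr p q"
proof -
  have "0 < cr p q * cr y0 x0 \<longleftrightarrow> 0 < weight p * weight q * (slope q - slope p)"
    unfolding cr_slope[OF assms] ..
  moreover have "0 < weight p * weight q" using assms by (simp add: in_sector_def)
  ultimately show ?thesis
    using cr_y0_x0 by (metis diff_gt_0_iff_gt mult_pos_pos zero_less_mult_pos zero_less_mult_pos2)
qed

lemma in_sector_sbetween:
  assumes "in_sector r" "in_sector l" "0 < cr r l" "sbetween r z l"
  shows "in_sector z"
proof -
  have 1: "cr y0 z * cr r l = cr r z * cr y0 l + cr z l * cr y0 r"
    "cr z x0 * cr r l = cr r z * cr l x0 + cr z l * cr r x0"
    by (simp_all add: cr_alt algebra_simps)
  have "0 \<le> cr y0 z * cr r l" "0 \<le> cr z x0 * cr r l"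
    unfolding 1 using assms by (auto simp: in_sector_def sbetween_def)
  moreover have "weight z * cr r l = cr r z * weight l + cr z l * weight r"
    unfolding weight_def distrib_right 1 by (simp add: algebra_simps)
  then have "0 < weight z * cr r l"
    using assms by (simp add: in_sector_def sbetween_def add_pos_pos)
  ultimately show ?thesis using assms(3) by (auto simp: in_sector_def zero_le_mult_iff zero_less_mult_iff)
qed

definition state_ok :: "state \<Rightarrow> bool" where
  "state_ok T \<longleftrightarrow> valid T \<and> in_sector (bd_l T - base) \<and> in_sector (bd_r T - base)"

definition width :: "state \<Rightarrow> real" where
  "width T = slope (bd_l T - base) - slope (bd_r T - base)"

lemma state_ok_start: "state_ok start"
  using valid_start cr_y0_x0 unfolding state_ok_def in_sector_def weight_def
  by (simp add: start_def x0_def y0_def)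

lemma width_start: "width start = 1"
  using cr_y0_x0 by (simp add: width_def start_def slope_def weight_def flip: x0_def y0_def)

lemma cr_bd: "valid T \<Longrightarrow> 0 < cr (bd_r T - base) (bd_l T - base)"
  by (simp add: valid_def beam_def)

lemma width_pos: "state_ok T \<Longrightarrow> 0 < width T"
  using slope_less_iff cr_bd by (simp add: state_ok_def width_def)

lemma apex_in_sector:
  assumes "state_ok T" "splits T"
  shows "in_sector (apex T - base)"
    "slope (bd_r T - base) < slope (apex T - base)" "slope (apex T - base) < slope (bd_l T - base)"
proof -
  show s: "in_sector (apex T - base)"
    using in_sector_sbetween cr_bd assms unfolding state_ok_def splits_def by blast
  show "slope (bd_r T - base) < slope (apex T - base)" "slope (apex T - base) < slope (bd_l T - base)"
    using s assms by (auto simp: slope_less_iff state_ok_def splits_def sbetween_def)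
qed

lemma children_ok:
  assumes T: "state_ok T" and T': "T' \<in> set (children T)"
  shows "state_ok T' \<and> slope (bd_r T - base) \<le> slope (bd_r T' - base) \<and>
    slope (bd_l T' - base) \<le> slope (bd_l T - base)"
proof (cases "splits T")
  case True
  obtain T1 T2 where "children T = [T1, T2]" "bd_l T1 = bd_l T" "bd_r T1 = apex T"
      "bd_l T2 = apex T" "bd_r T2 = bd_r T" using children_splits[OF True] by blast
  then show ?thesis
    using apex_in_sector[OF T True] T T' valid_children[of T T'] by (auto simp: state_ok_def)
next
  case False
  obtain T1 where "children T = [T1]" "bd_l T1 = bd_l T" "bd_r T1 = bd_r T"
    using children_not_splits[OF False] by blast
  then show ?thesis
    using T T' valid_children[of T T'] by (auto simp: state_ok_def)
qed

lemma descendants_ok: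
  assumes "state_ok T" "T' \<in> set (descendants n T)"
  shows "state_ok T' \<and> slope (bd_r T - base) \<le> slope (bd_r T' - base) \<and>
    slope (bd_l T' - base) \<le> slope (bd_l T - base)"
  using assms
proof (induction n arbitrary: T)
  case (Suc n)
  then obtain T1 where T1: "T1 \<in> set (children T)" "T' \<in> set (descendants n T1)" by auto
  then show ?case using children_ok[OF Suc.prems(1) T1(1)] Suc.IH[of T1] by fastforce
qed simp

text \<open>At a split the two intervals of slopes meet at the slope of the apex, so the sum
  telescopes.\<close>

lemma sum_width_children: "(\<Sum>t\<leftarrow>children T. width t) = width T"
proof (cases "splits T")
  case True
  obtain T1 T2 where "children T = [T1, T2]" "bd_l T1 = bd_l T" "bd_r T1 = apex T"
      "bd_l T2 = apex T" "bd_r T2 = bd_r T" using children_splits[OF True] by blast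
  then show ?thesis by (simp add: width_def)
next
  case False
  obtain T1 where "children T = [T1]" "bd_l T1 = bd_l T" "bd_r T1 = bd_r T"
    using children_not_splits[OF False] by blast
  then show ?thesis by (simp add: width_def)
qed

lemma sum_list_map_concat: "(\<Sum>x\<leftarrow>concat xss. f x) = (\<Sum>xs\<leftarrow>xss. \<Sum>x\<leftarrow>xs. f x)"
  for f :: "'b \<Rightarrow> 'c :: monoid_add"
  by (induction xss) auto

lemma sum_width_descendants: "(\<Sum>t\<leftarrow>descendants n T. width t) = width T"
proof (induction n arbitrary: T)
  case (Suc n)
  have "(\<lambda>t. \<Sum>s\<leftarrow>descendants n t. width s) = width" by (rule ext) (rule Suc)
  then show ?case by (simp add: sum_list_map_concat o_def sum_width_children)
qed simp

lemma split_points_in_sector: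
  assumes "state_ok T" "p \<in> split_points T k"
  shows "in_sector (p - base)" "slope (bd_r T - base) \<le> slope (p - base)" "slope (p - base) \<le> slope (bd_l T - base)"
proof -
  obtain T' i where T': "p = apex T'" "T' \<in> set (descendants i T)" "splits T'"
    using assms by (auto simp: split_points_def)
  have ok: "state_ok T'" "slope (bd_r T - base) \<le> slope (bd_r T' - base)"
    "slope (bd_l T' - base) \<le> slope (bd_l T - base)"
    using descendants_ok[OF assms(1) T'(2)] by auto
  show "in_sector (p - base)" "slope (bd_r T - base) \<le> slope (p - base)" "slope (p - base) \<le> slope (bd_l T - base)"
    using apex_in_sector[OF ok(1) T'(3)] ok unfolding T'(1) by linarith+
qed

lemma split_points_words:
  assumes "valid T" "p \<in> split_points T k"
  shows "\<exists>u e. p = W (word T) (W u (V e)) \<and> length u \<le> k \<and> set u \<subseteq> {..<3} \<and> e < 3 \<and>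
     p = W (u @ word T) (V e)"
proof -
  obtain T' i where T': "p = apex T'" "i < k" "T' \<in> set (descendants i T)"
    using assms by (auto simp: split_points_def)
  then show ?thesis
    using word_descendants[OF assms(1) T'(3)] valid_descendants[OF assms(1) T'(3)]
    by (auto simp: apex_def valid_def unfold_word_append intro!: exI[of _ "lab_a T'"])
qed

section \<open>Areas inside a thin beam\<close>

lemma abs_cr_thin:
  assumes "in_sector p" "in_sector q" "\<bar>slope p - slope q\<bar> \<le> \<delta>" "weight p \<le> \<Lambda>" "weight q \<le> \<Lambda>"
  shows "\<bar>cr p q\<bar> * cr y0 x0 \<le> \<Lambda>\<^sup>2 * \<delta>"
proof -
  have "\<bar>cr p q\<bar> * cr y0 x0 = weight p * weight q * \<bar>slope q - slope p\<bar>"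
    using cr_slope[OF assms(1,2)] cr_y0_x0 assms(1,2)
    by (metis abs_mult abs_of_pos in_sector_def)
  also have "\<dots> \<le> \<Lambda> * \<Lambda> * \<delta>"
    using assms by (intro mult_mono) (auto simp: in_sector_def)
  finally show ?thesis by (simp add: power2_eq_square)
qed

lemma abs_orient_thin:
  assumes "\<And>p. p \<in> {A, B, C} \<Longrightarrow> in_sector (p - base) \<and> s \<le> slope (p - base) \<and> slope (p - base) \<le> s + \<delta> \<and>
    weight (p - base) \<le> \<Lambda>"
  shows "\<bar>orient A B C\<bar> * cr y0 x0 \<le> 3 * \<Lambda>\<^sup>2 * \<delta>"
proof -
  let ?a = "A - base" and ?b = "B - base" and ?c = "C - base"
  have "orient A B C = orient ?a ?b ?c" by (simp add: orient_translate)
  also have "\<dots> = cr ?b ?c - cr ?b ?a - cr ?a ?c" by (rule orient_alt)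
  finally have "\<bar>orient A B C\<bar> \<le> \<bar>cr ?b ?c\<bar> + \<bar>cr ?b ?a\<bar> + \<bar>cr ?a ?c\<bar>" by linarith
  then have "\<bar>orient A B C\<bar> * cr y0 x0 \<le> (\<bar>cr ?b ?c\<bar> + \<bar>cr ?b ?a\<bar> + \<bar>cr ?a ?c\<bar>) * cr y0 x0"
    using cr_y0_x0 by (intro mult_right_mono) auto
  also have "\<dots> = \<bar>cr ?b ?c\<bar> * cr y0 x0 + \<bar>cr ?b ?a\<bar> * cr y0 x0 + \<bar>cr ?a ?c\<bar> * cr y0 x0"
    by (simp add: algebra_simps)
  also have "\<dots> \<le> \<Lambda>\<^sup>2 * \<delta> + \<Lambda>\<^sup>2 * \<delta> + \<Lambda>\<^sup>2 * \<delta>"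
    using assms[of A] assms[of B] assms[of C] by (intro add_mono abs_cr_thin) auto
  finally show ?thesis by (simp add: mult_ac)
qed

text \<open>Prepending a letter \<open>s\<close> moves the image of \<open>V e\<close> by exactly
  the distance from \<open>R s (V e)\<close> to \<open>V e\<close>, since the rest of the word is an
  isometry. Distances from the source, and with them the linear functional \<open>weight\<close>,
  grow at most linearly in the word length.\<close>

lemma weight_bound: "\<exists>M>0. \<forall>w e. set w \<subseteq> {..<3} \<and> e < 3 \<longrightarrow> weight (W w (V e) - base) \<le> M * real (length w + 1)"
proof -
  define K where "K = (\<Sum>s<3. \<Sum>e<3. norm (R s (V e) - V e)) + (\<Sum>e<3. norm (V e - base))"
  have K1: "norm (R s (V e) - V e) \<le> K" if "s < 3" "e < 3" for s e
  proof -
    have "norm (R s (V e) - V e) \<le> (\<Sum>e<3. norm (R s (V e) - V e))"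
      using that by (intro member_le_sum) auto
    also have "\<dots> \<le> (\<Sum>s<3. \<Sum>e<3. norm (R s (V e) - V e))"
      using that by (intro member_le_sum[where f = "\<lambda>s. \<Sum>e<3. norm (R s (V e) - V e)"] sum_nonneg) auto
    also have "\<dots> \<le> K" unfolding K_def by (simp add: sum_nonneg)
    finally show ?thesis .
  qed
  have K2: "norm (V e - base) \<le> K" if "e < 3" for e
  proof -
    have "norm (V e - base) \<le> (\<Sum>e<3. norm (V e - base))"
      using that by (intro member_le_sum) auto
    also have "\<dots> \<le> K" unfolding K_def by (simp add: sum_nonneg)
    finally show ?thesis .
  qed
  have K0: "0 \<le> K" unfolding K_def by (intro add_nonneg_nonneg sum_nonneg) auto
  have norm: "norm (W w (V e) - base) \<le> K * real (length w + 1)" if "set w \<subseteq> {..<3}" "e < 3" for w e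
    using that
  proof (induction w)
    case (Cons s w)
    have "norm (W (s # w) (V e) - base) \<le> norm (W w (R s (V e)) - W w (V e)) + norm (W w (V e) - base)"
      using norm_triangle_ineq[of "W w (R s (V e)) - W w (V e)" "W w (V e) - base"] by simp
    also have "\<dots> \<le> K + K * real (length w + 1)"
      using Cons K1[of s e] by (intro add_mono) (auto simp: norm_W)
    finally show ?case by (simp add: algebra_simps)
  qed (use K2 in simp)
  define M where "M = (norm y0 + norm x0) * K + 1"
  have "weight (W w (V e) - base) \<le> M * real (length w + 1)" if "set w \<subseteq> {..<3}" "e < 3" for w e
  proof -
    let ?p = "W w (V e) - base"
    have "weight ?p \<le> norm y0 * norm ?p + norm ?p * norm x0"
      unfolding weight_def using abs_cr_le[of y0 ?p] abs_cr_le[of ?p x0] by linarith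
    also have "\<dots> = (norm y0 + norm x0) * norm ?p" by (simp add: algebra_simps)
    also have "\<dots> \<le> (norm y0 + norm x0) * (K * real (length w + 1))"
      by (intro mult_left_mono norm that) auto
    also have "\<dots> \<le> M * real (length w + 1)" by (simp add: M_def algebra_simps)
    finally show ?thesis .
  qed
  moreover have "0 < M" using K0 by (simp add: M_def add_nonneg_pos)
  ultimately show ?thesis by blast
qed

text \<open>All splitting points have slopes in an interval of length \<delta> and weights linear in
  m + k, so \<open>small\<close> forces every triangle among them to have area below \<eta>. The
  isometry \<open>W (word T)\<close> changes orientations only by a sign; hence separation for words
  of length \<open>k\<close>, rather than m + k, turns small areas into zero ones.\<close>

lemma thin_beam_count:
  assumes M: "\<forall>w e. set w \<subseteq> {..<3} \<and> e < 3 \<longrightarrow> weight (W w (V e) - base) \<le> M * real (length w + 1)"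
    and M0: "0 < M"
    and sep: "separated \<alpha> \<beta> k \<eta>" and T: "T \<in> set (descendants m start)" and w: "width T \<le> \<delta>"
    and small: "3 * (M * real (m + k + 2))\<^sup>2 * \<delta> < \<eta> * cr y0 x0"
  shows "length (descendants k T) \<le> 2 * k + 1"
proof (rule beam_count)
  have ok: "state_ok T" using descendants_ok[OF state_ok_start T] by blast
  then show v: "valid T" by (simp add: state_ok_def)
  have len: "length (word T) = m + 1" "set (word T) \<subseteq> {..<3}"
    using word_descendants[OF valid_start T] v_less_3 by (auto simp: start_def)
  have pt: "\<exists>u e. p = W (word T) (W u (V e)) \<and> length u \<le> k \<and> set u \<subseteq> {..<3} \<and> e < 3 \<and>
      in_sector (p - base) \<and> slope (bd_r T - base) \<le> slope (p - base) \<and> slope (p - base) \<le> slope (bd_r T - base) + \<delta> \<and>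
      weight (p - base) \<le> M * real (m + k + 2)" if p: "p \<in> split_points T k" for p
  proof -
    obtain u e where u: "p = W (word T) (W u (V e))" "length u \<le> k" "set u \<subseteq> {..<3}" "e < 3" "p = W (u @ word T) (V e)"
      using split_points_words[OF v p] by blast
    have "weight (p - base) \<le> M * real (length (u @ word T) + 1)"
      unfolding u(5) using u(3,4) len(2) by (intro M[rule_format]) auto
    also have "\<dots> \<le> M * real (m + k + 2)"
      using M0 u len by (intro mult_left_mono) auto
    finally show ?thesis
      using u split_points_in_sector[OF ok p] w by (intro exI[of _ u] exI[of _ e]) (auto simp: width_def)
  qed
  show "collinear_set (split_points T k)"
    unfolding collinear_set_def
  proof (intro ballI)
    fix A B C assume ABC: "A \<in> split_points T k" "B \<in> split_points T k" "C \<in> split_points T k"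
    obtain u1 e1 u2 e2 u3 e3 where
      u: "A = W (word T) (W u1 (V e1))" "length u1 \<le> k" "set u1 \<subseteq> {..<3}" "e1 < 3"
        "B = W (word T) (W u2 (V e2))" "length u2 \<le> k" "set u2 \<subseteq> {..<3}" "e2 < 3"
        "C = W (word T) (W u3 (V e3))" "length u3 \<le> k" "set u3 \<subseteq> {..<3}" "e3 < 3"
      using pt[OF ABC(1)] pt[OF ABC(2)] pt[OF ABC(3)] by blast
    have "\<bar>orient A B C\<bar> * cr y0 x0 \<le> 3 * (M * real (m + k + 2))\<^sup>2 * \<delta>"
      by (rule abs_orient_thin[of _ _ _ "slope (bd_r T - base)"]) (use ABC pt in blast)
    also have "\<dots> < \<eta> * cr y0 x0" by (rule small)
    finally have lt: "\<bar>orient A B C\<bar> < \<eta>" using cr_y0_x0 by simp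
    have "orient A B C = (- 1) ^ length (word T) * orient (W u1 (V e1)) (W u2 (V e2)) (W u3 (V e3))"
      unfolding u by (rule orient_W)
    then have "orient A B C = 0 \<longleftrightarrow> orient (W u1 (V e1)) (W u2 (V e2)) (W u3 (V e3)) = 0"
      "\<bar>orient A B C\<bar> = \<bar>orient (W u1 (V e1)) (W u2 (V e2)) (W u3 (V e3))\<bar>"
      by (simp_all add: abs_mult)
    moreover have "orient (W u1 (V e1)) (W u2 (V e2)) (W u3 (V e3)) = 0 \<or>
      \<eta> \<le> \<bar>orient (W u1 (V e1)) (W u2 (V e2)) (W u3 (V e3))\<bar>"
      by (rule sep[unfolded separated_def, rule_format]) (use u in simp)
    ultimately show "orient A B C = 0" using lt by linarith
  qed
qed

section \<open>Recursion for the number of beams\<close>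

text \<open>A thin beam has at most 2k + 1 descendants. A wide one has at most 2^k, which is less
  than 2^k/\<delta> times its width. Charging wide beams to their width and summing widths to 1
  yields the additive term.\<close>

lemma count_step:
  assumes M: "\<forall>w e. set w \<subseteq> {..<3} \<and> e < 3 \<longrightarrow> weight (W w (V e) - base) \<le> M * real (length w + 1)"
    and M0: "0 < M"
    and sep: "separated \<alpha> \<beta> k \<eta>" and \<delta>: "0 < \<delta>"
    and small: "3 * (M * real (m + k + 2))\<^sup>2 * \<delta> < \<eta> * cr y0 x0"
  shows "real (length (descendants (m + k) start)) \<le> (2 * real k + 1) * real (length (descendants m start)) + 2 ^ k / \<delta>"
proof -
  have "real (length (descendants (m + k) start)) = (\<Sum>t\<leftarrow>descendants m start. real (length (descendants k t)))"
    unfolding descendants_add by (simp add: length_concat o_def flip: sum_list_of_nat)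
  also have "\<dots> \<le> (\<Sum>t\<leftarrow>descendants m start. (2 * real k + 1) + 2 ^ k / \<delta> * width t)"
  proof (rule sum_list_mono)
    fix t assume t: "t \<in> set (descendants m start)"
    have w: "0 < width t" using descendants_ok[OF state_ok_start t] width_pos by blast
    show "real (length (descendants k t)) \<le> (2 * real k + 1) + 2 ^ k / \<delta> * width t"
    proof (cases "width t \<le> \<delta>")
      case True
      have "real (length (descendants k t)) \<le> real (2 * k + 1)"
        unfolding of_nat_le_iff by (rule thin_beam_count[OF M M0 sep t True small])
      moreover have "0 \<le> 2 ^ k / \<delta> * width t" using w \<delta> by simp
      ultimately show ?thesis by (simp del: of_nat_mult)
    next
      case False
      have "real (length (descendants k t)) \<le> real (2 ^ k)"
        unfolding of_nat_le_iff by (rule length_descendants_le)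
      also have "\<dots> \<le> 2 ^ k / \<delta> * width t"
        using False \<delta> by (simp add: field_simps)
      finally show ?thesis by simp
    qed
  qed
  also have "\<dots> = (2 * real k + 1) * real (length (descendants m start)) + 2 ^ k / \<delta> * (\<Sum>t\<leftarrow>descendants m start. width t)"
    by (simp add: sum_list_addf sum_list_const_mult sum_list_triv del: times_divide_eq_left) (simp add: algebra_simps)
  finally show ?thesis by (simp add: sum_width_descendants width_start)
qed

text \<open>The left side of \<open>small\<close> grows with \<open>q\<close>, so the condition for
  the last round implies it for all earlier ones, and the same \<delta> serves throughout.\<close>

lemma count_iterate:
  assumes M: "\<forall>w e. set w \<subseteq> {..<3} \<and> e < 3 \<longrightarrow> weight (W w (V e) - base) \<le> M * real (length w + 1)"
    and M0: "0 < M"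
    and sep: "separated \<alpha> \<beta> k \<eta>" and \<delta>: "0 < \<delta>"
    and small: "3 * (M * real (q * k + 2))\<^sup>2 * \<delta> < \<eta> * cr y0 x0"
  shows "real (length (descendants (q * k) start)) \<le> (2 * real k + 1) ^ q * (1 + real q * (2 ^ k / \<delta>))"
  using small
proof (induction q)
  case (Suc q)
  define B where "B = 2 ^ k / \<delta>"
  have B: "0 \<le> B" using \<delta> by (simp add: B_def)
  have "3 * (M * real (q * k + 2))\<^sup>2 * \<delta> \<le> 3 * (M * real (Suc q * k + 2))\<^sup>2 * \<delta>"
    using M0 \<delta> by (intro mult_right_mono mult_left_mono power_mono) auto
  then have IH: "real (length (descendants (q * k) start)) \<le> (2 * real k + 1) ^ q * (1 + real q * B)"
    using Suc by (auto simp: B_def)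
  have "real (length (descendants (q * k + k) start)) \<le> (2 * real k + 1) * real (length (descendants (q * k) start)) + B"
    unfolding B_def by (rule count_step[OF M M0 sep \<delta>]) (use Suc.prems in \<open>simp add: add_ac\<close>)
  also have "\<dots> \<le> (2 * real k + 1) * ((2 * real k + 1) ^ q * (1 + real q * B)) + (2 * real k + 1) ^ Suc q * B"
  proof (intro add_mono mult_left_mono IH)
    have "1 \<le> (2 * real k + 1) ^ Suc q" by (intro one_le_power) auto
    then show "B \<le> (2 * real k + 1) ^ Suc q * B" using B mult_right_mono[of 1 _ B] by simp
  qed auto
  finally show ?case by (simp add: B_def[symmetric] algebra_simps)
qed simp

end

section \<open>Generalized diagonals\<close>

lemma orient_rotate: "orient p q t = orient q t p"
  by (simp add: orient_def cr_alt algebra_simps)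

lemma orient_degenerate: "orient p q p = 0" "orient p q q = 0"
  by (simp_all add: orient_def cr_alt)

context triangle
begin

section \<open>Barycentric coordinates and the boundary of the triangle\<close>

text \<open>The unnormalised barycentric coordinate of vertex \<open>i\<close>.\<close>

definition side_val :: "nat \<Rightarrow> complex \<Rightarrow> real" where
  "side_val i p = orient (V ((i + 1) mod 3)) (V ((i + 2) mod 3)) p"

lemma side_val_affine: "side_val i ((1 - t) *\<^sub>R p + t *\<^sub>R q) = (1 - t) * side_val i p + t * side_val i q"
  by (simp add: side_val_def orient_def cr_alt algebra_simps)

lemma side_val_V:
  assumes "i < 3" "j < 3"
  shows "i \<noteq> j \<Longrightarrow> side_val i (V j) = 0" and "0 < side_val i (V i)"
proof -
  show "0 < side_val i (V i)"
    unfolding side_val_def by (rule orient_V[OF assms(1), unfolded orient_rotate[of "V i"]])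
  assume "i \<noteq> j"
  moreover have "(0 + 1) mod 3 = (1::nat)" "(0 + 2) mod 3 = (2::nat)" "(1 + 1) mod 3 = (2::nat)"
    "(1 + 2) mod 3 = (0::nat)" "(2 + 1) mod 3 = (0::nat)" "(2 + 2) mod 3 = (1::nat)"
    by simp_all
  ultimately have "j = (i + 1) mod 3 \<or> j = (i + 2) mod 3" using assms unfolding less_3_cases by metis
  then show "side_val i (V j) = 0"
    unfolding side_val_def by (elim disjE) (simp_all only: orient_degenerate)
qed

lemma tri_verts_cases:
  assumes "p \<in> tri_verts \<alpha> \<beta>"
  obtains c where "c < 3" "p = V c"
  using assms that[of 0] that[of 1] that[of 2] by (auto simp: tri_verts_def)

lemma side_val_pos_interior:
  assumes p: "p \<in> interior (convex hull tri_verts \<alpha> \<beta>)" and i: "i < 3"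
  shows "0 < side_val i p"
proof -
  define a d where "a = V ((i + 1) mod 3)" and "d = V ((i + 2) mod 3) - a"
  have sv: "side_val i q = inner (\<i> * d) q - inner (\<i> * d) a" for q
    unfolding side_val_def orient_def a_def[symmetric] d_def[symmetric]
    by (simp add: cr_alt inner_complex_def algebra_simps)
  have "0 < side_val i (V i)" using side_val_V i by blast
  then have d: "\<i> * d \<noteq> 0" unfolding sv by auto
  have "tri_verts \<alpha> \<beta> \<subseteq> {q. inner (\<i> * d) q \<ge> inner (\<i> * d) a}"
  proof
    fix q assume "q \<in> tri_verts \<alpha> \<beta>"
    then obtain j where j: "j < 3" "q = V j" by (rule tri_verts_cases)
    then have "0 \<le> side_val i q" using side_val_V[OF i, of j] by (cases "i = j") auto
    then show "q \<in> {q. inner (\<i> * d) q \<ge> inner (\<i> * d) a}" by (simp add: sv)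
  qed
  then have "convex hull tri_verts \<alpha> \<beta> \<subseteq> {q. inner (\<i> * d) q \<ge> inner (\<i> * d) a}"
    by (rule hull_minimal) (rule convex_halfspace_ge)
  then have "interior (convex hull tri_verts \<alpha> \<beta>) \<subseteq> {q. inner (\<i> * d) q > inner (\<i> * d) a}"
    using interior_mono interior_halfspace_ge[OF d] by metis
  then show ?thesis using p by (auto simp: sv)
qed

lemma side_val_open_segment:
  assumes "p \<in> open_segment (V a) (V b)" "distinct [a, b, s]" "a < 3" "b < 3" "s < 3"
  shows "side_val s p = 0" "0 < side_val a p" "0 < side_val b p"
proof -
  obtain t where t: "0 < t" "t < 1" "p = (1 - t) *\<^sub>R V a + t *\<^sub>R V b"
    using assms(1) by (auto simp: in_segment)
  show "side_val s p = 0" "0 < side_val a p" "0 < side_val b p"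
    unfolding t(3) side_val_affine using assms t side_val_V by simp_all
qed

text \<open>Squaring removes the choice of direction along the side. The value is the linear part of
  \<open>refl_side\<close>, which links the reflection law of \<open>gen_diag\<close> to the
  unfolding.\<close>

lemma sgn_side:
  assumes "distinct [a, b, s]" "a < 3" "b < 3" "s < 3"
  shows "(sgn (V b - V a))\<^sup>2 = refl_dir s"
proof -
  have sgn: "sgn (of_real r * cis t) = cis t" "sgn (- (of_real r * cis t)) = - cis t" if "0 < r" for r t
    using that by (simp_all add: sgn_eq norm_mult)
  have 01: "V 1 - V 0 = 1" "V 0 - V 1 = - 1" by (simp_all add: tri_vert_def)
  have 02: "V 2 - V 0 = of_real (sin \<beta> / sin (\<alpha> + \<beta>)) * cis \<alpha>"
    "V 0 - V 2 = - (of_real (sin \<beta> / sin (\<alpha> + \<beta>)) * cis \<alpha>)" by (simp_all add: tri_vert_def)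
  have 12: "V 2 - V 1 = - (of_real (sin \<alpha> / sin (\<alpha> + \<beta>)) * cis (- \<beta>))"
    "V 1 - V 2 = of_real (sin \<alpha> / sin (\<alpha> + \<beta>)) * cis (- \<beta>)"
    using V2_minus_V1 by (simp, metis V2_minus_V1 minus_diff_eq minus_minus mult_minus_left)
  have pos: "0 < sin \<beta> / sin (\<alpha> + \<beta>)" "0 < sin \<alpha> / sin (\<alpha> + \<beta>)" using sin_pos by simp_all
  have sq: "(sgn (V 1 - V 0))\<^sup>2 = 1" "(sgn (V 0 - V 1))\<^sup>2 = 1"
    "(sgn (V 2 - V 0))\<^sup>2 = cis (2 * \<alpha>)" "(sgn (V 0 - V 2))\<^sup>2 = cis (2 * \<alpha>)"
    "(sgn (V 2 - V 1))\<^sup>2 = cis (- 2 * \<beta>)" "(sgn (V 1 - V 2))\<^sup>2 = cis (- 2 * \<beta>)"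
    unfolding 01 02 12 sgn(1)[OF pos(1)] sgn(2)[OF pos(1)] sgn(1)[OF pos(2)] sgn(2)[OF pos(2)]
    by (simp_all add: power2_eq_square cis_mult sgn_minus)
  have "a = 0 \<or> a = 1 \<or> a = 2" "b = 0 \<or> b = 1 \<or> b = 2" "s = 0 \<or> s = 1 \<or> s = 2"
    using assms by linarith+
  then show ?thesis using assms(1)
    by (elim disjE; hypsubst; simp only: sq refl_dir_def; simp)
qed

lemma third_label:
  assumes "a < 3" "b < 3" "a \<noteq> (b::nat)"
  obtains s where "s < 3" "distinct [a, b, s]"
proof
  show "3 - a - b < 3" using assms by arith
  have "a \<noteq> 3 - a - b" "b \<noteq> 3 - a - b" using assms by arith+
  then show "distinct [a, b, 3 - a - b]" using assms(3) by simp
qed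

lemma on_side_cases:
  assumes "on_side \<alpha> \<beta> p u"
  obtains a b s where "a < 3" "b < 3" "s < 3" "distinct [a, b, s]" "p \<in> open_segment (V a) (V b)" "u\<^sup>2 = refl_dir s"
proof -
  obtain a b where ab: "a < 3" "b < 3" "a \<noteq> b" "p \<in> open_segment (V a) (V b)" "u = sgn (V b - V a)"
    using assms by (auto simp: on_side_def)
  obtain s where s: "s < 3" "distinct [a, b, s]" using third_label[OF ab(1-3)] .
  show thesis using that[OF ab(1,2) s ab(4)] sgn_side[OF s(2) ab(1,2) s(1)] ab(5) by simp
qed

lemma on_side_refl_dir:
  assumes "on_side \<alpha> \<beta> p u" "p \<in> open_segment (V a) (V b)" "distinct [a, b, s]" "a < 3" "b < 3" "s < 3"
  shows "u\<^sup>2 = refl_dir s"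
proof -
  obtain a' b' s' where *: "a' < 3" "b' < 3" "s' < 3" "distinct [a', b', s']" "p \<in> open_segment (V a') (V b')" "u\<^sup>2 = refl_dir s'"
    using on_side_cases[OF assms(1)] .
  have 0: "side_val s p = 0" using side_val_open_segment[OF assms(2-)] by simp
  have "s \<noteq> a'" "s \<noteq> b'" using 0 side_val_open_segment[OF *(5,4,1-3)] by auto
  then have "s = s'" using *(1-4) assms(6) by auto
  then show ?thesis using * by simp
qed

lemma on_side_unique:
  assumes "on_side \<alpha> \<beta> p u" "on_side \<alpha> \<beta> p u'"
  shows "u\<^sup>2 = u'\<^sup>2"
  using on_side_cases[OF assms(1)] on_side_refl_dir[OF assms(2)] by metis

text \<open>Used to show that no diagonal is a proper initial part of another: a final vertex cannot
  be a reflection point.\<close>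

lemma vertex_not_on_side:
  assumes "p \<in> tri_verts \<alpha> \<beta>"
  shows "\<not> on_side \<alpha> \<beta> p u"
proof
  assume "on_side \<alpha> \<beta> p u"
  then obtain a b s where *: "a < 3" "b < 3" "s < 3" "distinct [a, b, s]" "p \<in> open_segment (V a) (V b)"
    by (rule on_side_cases) blast
  obtain c where c: "c < 3" "p = V c" using tri_verts_cases[OF assms] .
  have "side_val a p \<noteq> 0" "side_val b p \<noteq> 0" using side_val_open_segment[OF *(5,4,1-3)] by auto
  then have "a = c" "b = c" using c *(1,2) side_val_V(1) by metis+
  then show False using * by simp
qed

definition frontier_point :: "complex \<Rightarrow> bool" where
  "frontier_point p \<longleftrightarrow> p \<in> tri_verts \<alpha> \<beta> \<or> (\<exists>u. on_side \<alpha> \<beta> p u)"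

lemma frontier_point_side_val:
  assumes "frontier_point p"
  shows "\<exists>i<3. side_val i p = 0"
  using assms unfolding frontier_point_def
proof
  assume "p \<in> tri_verts \<alpha> \<beta>"
  then obtain c where c: "c < 3" "p = V c" by (rule tri_verts_cases)
  have "side_val (if c = 0 then 1 else 0) p = 0" using c side_val_V(1)[of _ c] by simp
  then show ?thesis by (metis less_3_cases)
next
  assume "\<exists>u. on_side \<alpha> \<beta> p u"
  then obtain u where "on_side \<alpha> \<beta> p u" ..
  then show ?thesis by (rule on_side_cases) (metis side_val_open_segment(1))
qed

text \<open>Otherwise the nearer point would lie on the open segment to the farther one, hence in
  the interior, although one of its barycentric coordinates is zero.\<close>

lemma ray_hits_once:
  assumes q: "frontier_point q" and q': "frontier_point q'" and ne: "p \<noteq> q" "p \<noteq> q'"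
    and int: "open_segment p q \<subseteq> interior (convex hull tri_verts \<alpha> \<beta>)"
    and int': "open_segment p q' \<subseteq> interior (convex hull tri_verts \<alpha> \<beta>)"
    and s: "sgn (q - p) = sgn (q' - p)"
  shows "q = q'"
proof -
  have aux: "\<not> norm (q - p) < norm (q' - p)"
    if "frontier_point q" "p \<noteq> q" "p \<noteq> q'" "open_segment p q' \<subseteq> interior (convex hull tri_verts \<alpha> \<beta>)"
      "sgn (q - p) = sgn (q' - p)" for q q'
  proof
    assume lt: "norm (q - p) < norm (q' - p)"
    define t where "t = norm (q - p) / norm (q' - p)"
    have t: "0 < t" "t < 1" using lt that by (auto simp: t_def)
    have "q - p = norm (q - p) *\<^sub>R sgn (q - p)" using that(2) by (simp add: sgn_div_norm)
    also have "\<dots> = t *\<^sub>R (q' - p)" unfolding that(5) by (simp add: sgn_div_norm t_def divide_inverse)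
    finally have "q = (1 - t) *\<^sub>R p + t *\<^sub>R q'" by (simp add: algebra_simps)
    then have "q \<in> open_segment p q'" using t that by (auto simp: in_segment)
    then show False using that(4) frontier_point_side_val[OF that(1)] side_val_pos_interior[of q] by fastforce
  qed
  have "norm (q - p) = norm (q' - p)"
    using aux[OF q ne int' s] aux[OF q' ne(2,1) int s[symmetric]] by linarith
  moreover have "q - p = norm (q - p) *\<^sub>R sgn (q - p)" "q' - p = norm (q' - p) *\<^sub>R sgn (q' - p)"
    using ne by (simp_all add: sgn_div_norm)
  ultimately have "q - p = q' - p" using s by metis
  then show ?thesis by simp
qed

lemma midpoint_open_segment:
  assumes "p \<noteq> q"
  shows "midpoint p q \<in> open_segment p q"
  using assms by simp

lemma side_val_midpoint: "side_val i (midpoint p q) = (side_val i p + side_val i q) / 2"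
  by (simp add: midpoint_def side_val_def orient_def cr_alt field_simps)

text \<open>The midpoint is interior, and its coordinate is half that of \<open>q\<close>. A
  trajectory leaving a side therefore ends its segment off the line of that side.\<close>

lemma next_side_val:
  assumes "p \<noteq> q" "open_segment p q \<subseteq> interior (convex hull tri_verts \<alpha> \<beta>)" "i < 3" "side_val i p = 0"
  shows "0 < side_val i q"
proof -
  have "midpoint p q \<in> interior (convex hull tri_verts \<alpha> \<beta>)"
    using midpoint_open_segment[OF assms(1)] assms(2) by blast
  then show ?thesis
    using side_val_pos_interior[of "midpoint p q" i] assms by (simp add: side_val_midpoint)
qed

lemma next_on_side:
  assumes "on_side \<alpha> \<beta> q u" "0 < side_val e q" "distinct [i, j, e]" "i < 3" "j < 3" "e < 3"
  shows "q \<in> open_segment (V i) (V e) \<or> q \<in> open_segment (V e) (V j)"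
proof -
  obtain a b s where *: "a < 3" "b < 3" "s < 3" "distinct [a, b, s]" "q \<in> open_segment (V a) (V b)"
    by (rule on_side_cases[OF assms(1)])
  have "e \<noteq> s" using side_val_open_segment[OF *(5,4,1-3)] assms(2) by auto
  then have "e = a \<or> e = b" using * assms(6) by auto
  moreover have "a \<in> {i, j, e}" "b \<in> {i, j, e}" using * assms(3-6) by auto
  ultimately have "(a = e \<and> b = i) \<or> (a = e \<and> b = j) \<or> (b = e \<and> a = i) \<or> (b = e \<and> a = j)"
    using * by auto
  then show ?thesis using *(5) by (auto simp: open_segment_commute)
qed

lemma next_vertex:
  assumes "q \<in> tri_verts \<alpha> \<beta>" "0 < side_val e q" "e < 3"
  shows "q = V e"
proof -
  obtain c where c: "c < 3" "q = V c" using tri_verts_cases[OF assms(1)] .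
  then have "c = e" using assms side_val_V(1)[OF assms(3) c(1)] by (metis less_irrefl)
  then show ?thesis using c by simp
qed

lemma R_open_segment:
  assumes "p \<in> open_segment (V a) (V b)" "distinct [a, b, s]" "a < 3" "b < 3" "s < 3"
  shows "R s p = p"
proof -
  obtain t where t: "p = (1 - t) *\<^sub>R V a + t *\<^sub>R V b"
    using assms(1) by (auto simp: in_segment)
  have ab: "R s (V a) = V a" "R s (V b) = V b" using assms by (auto intro!: R_V)
  have "p - V a = of_real t * (V b - V a)" by (simp add: t algebra_simps scaleR_conv_of_real)
  then have "R s p - R s (V a) = of_real t * (R s (V b) - R s (V a))"
    unfolding R_diff by simp
  then show ?thesis unfolding ab using \<open>p - V a = _\<close> by (metis diff_add_cancel)
qed

end

section \<open>Generalized diagonals and their initial directions\<close>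

context pointed_triangle
begin

lemma gen_diag_props:
  assumes "gen_diag \<alpha> \<beta> v ps"
  shows "2 \<le> length ps" "ps ! 0 = base" "ps ! (length ps - 1) \<in> tri_verts \<alpha> \<beta>"
    "\<And>j. j + 1 < length ps \<Longrightarrow> ps ! j \<noteq> ps ! (j + 1)"
    "\<And>j. j + 1 < length ps \<Longrightarrow> open_segment (ps ! j) (ps ! (j + 1)) \<subseteq> interior (convex hull tri_verts \<alpha> \<beta>)"
    "\<And>j. 0 < j \<Longrightarrow> j + 1 < length ps \<Longrightarrow> \<exists>u. on_side \<alpha> \<beta> (ps ! j) u \<and>
               sgn (ps ! (j + 1) - ps ! j) = u\<^sup>2 * cnj (sgn (ps ! j - ps ! (j - 1)))"
proof -
  have "ps \<noteq> []" using assms by (auto simp: gen_diag_def)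
  then show "ps ! 0 = base" "ps ! (length ps - 1) \<in> tri_verts \<alpha> \<beta>"
    using assms by (auto simp: gen_diag_def base_def hd_conv_nth last_conv_nth)
qed (use assms in \<open>unfold gen_diag_def, blast+\<close>)

lemma gen_diag_frontier:
  assumes "gen_diag \<alpha> \<beta> v ps" "j < length ps"
  shows "frontier_point (ps ! j)"
proof -
  note P = gen_diag_props[OF assms(1)]
  consider "j = 0" | "0 < j" "j + 1 < length ps" | "j = length ps - 1" using assms by linarith
  then show ?thesis
  proof cases
    case 1
    have "V v \<in> tri_verts \<alpha> \<beta>" using v_less_3 unfolding less_3_cases tri_verts_def by auto
    then show ?thesis using 1 P(2) by (simp add: base_def frontier_point_def)
  qed (use P(3,6) in \<open>auto simp: frontier_point_def\<close>)
qed

text \<open>The reflection law in unfolded form: once the next segment is mirrored in the side just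
  hit, the trajectory goes straight on. The factor \<open>c\<close> is the ratio of the lengths of
  the two segments.\<close>

lemma gen_diag_reflect:
  assumes "gen_diag \<alpha> \<beta> v ps" "0 < j" "j + 1 < length ps"
    and "ps ! j \<in> open_segment (V a) (V b)" "distinct [a, b, s]" "a < 3" "b < 3" "s < 3"
  shows "\<exists>c>0. R s (ps ! (j + 1)) - R s (ps ! j) = of_real c * (ps ! j - ps ! (j - 1))"
proof -
  note P = gen_diag_props[OF assms(1)]
  obtain u where u: "on_side \<alpha> \<beta> (ps ! j) u" "sgn (ps ! (j + 1) - ps ! j) = u\<^sup>2 * cnj (sgn (ps ! j - ps ! (j - 1)))"
    using P(6)[OF assms(2,3)] by blast
  have u2: "u\<^sup>2 = refl_dir s" by (rule on_side_refl_dir[OF u(1) assms(4-)])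
  define A B where "A = ps ! (j + 1) - ps ! j" and "B = ps ! j - ps ! (j - 1)"
  have n0: "A \<noteq> 0" "B \<noteq> 0" using P(4)[of j] P(4)[of "j - 1"] assms(2,3) by (auto simp: A_def B_def)
  have "refl_dir s * cnj (refl_dir s) = 1" by (simp add: complex_norm_square[symmetric])
  then have "refl_dir s * cnj (sgn A) = sgn B"
    using u(2) unfolding u2 A_def[symmetric] B_def[symmetric]
    by (simp add: mult.assoc[symmetric])
  moreover have "A = of_real (norm A) * sgn A" "sgn B = B / of_real (norm B)"
    using n0 by (simp_all add: sgn_eq)
  ultimately have "refl_dir s * cnj A = of_real (norm A / norm B) * B"
    by (metis (no_types, lifting) complex_cnj_complex_of_real complex_cnj_mult mult.left_commute of_real_divide
        times_divide_eq_left times_divide_eq_right)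
  then show ?thesis using n0 unfolding R_diff A_def[symmetric] B_def[symmetric]
    by (intro exI[of _ "norm A / norm B"]) auto
qed

text \<open>The direction fixes the next break point by \<open>ray_hits_once\<close>, and the side
  hit there fixes the next direction. Equal lengths follow because a diagonal ends at a vertex,
  where no reflection can take place.\<close>

lemma gen_diag_inj:
  assumes ps: "gen_diag \<alpha> \<beta> v ps" and qs: "gen_diag \<alpha> \<beta> v qs"
    and dir: "sgn (ps ! 1 - ps ! 0) = sgn (qs ! 1 - qs ! 0)"
  shows "ps = qs"
proof -
  note P = gen_diag_props[OF ps] and Q = gen_diag_props[OF qs]
  have step: "ps ! (j + 1) = qs ! (j + 1)"
    if "j + 1 < length ps" "j + 1 < length qs" "ps ! j = qs ! j" "sgn (ps ! (j + 1) - ps ! j) = sgn (qs ! (j + 1) - qs ! j)" for j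
    by (rule ray_hits_once[OF gen_diag_frontier[OF ps that(1)] gen_diag_frontier[OF qs that(2)]
          P(4)[OF that(1)] _ P(5)[OF that(1)]])
      (use Q(4,5)[OF that(2)] that(3,4) in \<open>simp_all only:\<close>, simp)
  have main: "ps ! j = qs ! j \<and> sgn (ps ! (j + 1) - ps ! j) = sgn (qs ! (j + 1) - qs ! j)"
    if "j + 1 < length ps" "j + 1 < length qs" for j
    using that
  proof (induction j)
    case 0
    then show ?case using P(2) Q(2) dir by simp
  next
    case (Suc j)
    then have IH: "ps ! j = qs ! j" "sgn (ps ! (j + 1) - ps ! j) = sgn (qs ! (j + 1) - qs ! j)" by auto
    have eq: "ps ! (j + 1) = qs ! (j + 1)" using step[of j] IH Suc.prems by auto
    obtain u where u: "on_side \<alpha> \<beta> (ps ! Suc j) u" "sgn (ps ! (Suc j + 1) - ps ! Suc j) = u\<^sup>2 * cnj (sgn (ps ! Suc j - ps ! j))"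
      using P(6)[of "Suc j"] Suc.prems by auto
    obtain u' where u': "on_side \<alpha> \<beta> (qs ! Suc j) u'" "sgn (qs ! (Suc j + 1) - qs ! Suc j) = u'\<^sup>2 * cnj (sgn (qs ! Suc j - qs ! j))"
      using Q(6)[of "Suc j"] Suc.prems by auto
    have "u\<^sup>2 = u'\<^sup>2" using on_side_unique[OF u(1), of u'] u'(1) eq by simp
    then show ?case using u(2) u'(2) eq IH by (metis Suc_eq_plus1)
  qed
  have all: "ps ! j = qs ! j" if "j < length ps" "j < length qs" for j
  proof (cases j)
    case 0
    then show ?thesis using P(2) Q(2) by simp
  next
    case (Suc i)
    then show ?thesis using main[of i] step[of i] that by auto
  qed
  have "\<not> length ps < length qs"
  proof
    assume lt: "length ps < length qs"
    have "on_side \<alpha> \<beta> (qs ! (length ps - 1)) u \<Longrightarrow> False" for u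
      using vertex_not_on_side[OF P(3)] all[of "length ps - 1"] lt P(1) by auto
    moreover have "0 < length ps - 1" "length ps - 1 + 1 < length qs" using lt P(1) by auto
    ultimately show False using Q(6) by blast
  qed
  moreover have "\<not> length qs < length ps"
  proof
    assume lt: "length qs < length ps"
    have "on_side \<alpha> \<beta> (ps ! (length qs - 1)) u \<Longrightarrow> False" for u
      using vertex_not_on_side[OF Q(3)] all[of "length qs - 1"] lt Q(1) by auto
    moreover have "0 < length qs - 1" "length qs - 1 + 1 < length ps" using lt Q(1) by auto
    ultimately show False using P(6) by blast
  qed
  ultimately have "length ps = length qs" by simp
  then show ?thesis using all by (intro nth_equalityI) auto
qed

end

section \<open>Following a diagonal through the tree of beams\<close>

text \<open>The trajectory crosses the current side at \<open>p\<close> and leaves through the side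
  from \<open>z\<close> to \<open>y\<close> at a multiple of \<open>p\<close>. It then has
  \<open>z\<close> on its left, and so has the right bounding ray. Hence the beam either splits at
  \<open>z\<close> or passes entirely to the right of it, and in both cases one child crosses the
  side that the trajectory crosses.\<close>

lemma turn_right:
  assumes B: "beam x y z l r" and b: "0 < b" "b < 1" and a: "0 < a" "a < 1" and k: "0 < k"
    and p: "p = of_real (1 - b) * x + of_real b * y"
    and q: "of_real k * p = of_real (1 - a) * z + of_real a * y"
    and s: "sbetween r p l"
  shows "0 < cr p z" "0 < cr r z"
proof -
  have yp: "cr y p = (1 - b) * cr y x" unfolding p by (simp add: cr_alt algebra_simps)
  then have yp0: "0 < cr y p" using B b by (simp add: beam_def)
  have "k * cr y p = cr y (of_real k * p)" by (simp add: cr_alt algebra_simps)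
  also have "\<dots> = (1 - a) * cr y z" unfolding q by (simp add: cr_alt algebra_simps)
  finally have "0 < (1 - a) * cr y z" using k yp0 by (metis mult_pos_pos)
  then have yz: "0 < cr y z" using a by (simp add: zero_less_mult_iff)
  have "k * cr p z = cr (of_real k * p) z" by (simp add: cr_alt algebra_simps)
  also have "\<dots> = a * cr y z" unfolding q by (simp add: cr_alt algebra_simps)
  finally have "0 < k * cr p z" using a yz by simp
  then show pz: "0 < cr p z" using k by (simp add: zero_less_mult_iff)
  have "cr r z * cr y p = cr r p * cr y z + cr y r * cr p z" by (simp add: cr_alt algebra_simps)
  moreover have "0 < cr r p * cr y z + cr y r * cr p z"
    using s B pz yz by (intro add_pos_nonneg) (auto simp: sbetween_def beam_def)
  ultimately have "0 < cr r z * cr y p" by simp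
  then show "0 < cr r z" using yp0 by (simp add: zero_less_mult_iff)
qed

lemma turn_left:
  assumes B: "beam x y z l r" and b: "0 < b" "b < 1" and a: "0 < a" "a < 1" and k: "0 < k"
    and p: "p = of_real (1 - b) * x + of_real b * y"
    and q: "of_real k * p = of_real (1 - a) * x + of_real a * z"
    and s: "sbetween r p l"
  shows "0 < cr z p" "0 < cr z l"
proof -
  have B': "beam (cnj y) (cnj x) (cnj z) (cnj r) (cnj l)" using B by (simp add: beam_cnj)
  have p': "cnj p = of_real (1 - (1 - b)) * cnj y + of_real (1 - b) * cnj x"
    unfolding p by simp
  have "cnj (of_real k * p) = cnj (of_real (1 - a) * x + of_real a * z)" using q by simp
  then have q': "of_real k * cnj p = of_real (1 - (1 - a)) * cnj z + of_real (1 - a) * cnj x"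
    by simp
  have s': "sbetween (cnj l) (cnj p) (cnj r)" using s by (simp add: sbetween_def cr_cnj)
  show "0 < cr z p" "0 < cr z l"
    using turn_right[OF B' _ _ _ _ k p' q' s'] a b by (simp_all add: cr_cnj)
qed

lemma cr_scale: "cr (of_real k * p) q = k * cr p q" "cr q (of_real k * p) = k * cr q p"
  by (simp_all add: cr_alt algebra_simps)

context pointed_triangle
begin

lemma W_open_segment:
  assumes "p \<in> open_segment (V a) (V b)"
  shows "\<exists>t. 0 < t \<and> t < 1 \<and> W w p - base = of_real (1 - t) * (W w (V a) - base) + of_real t * (W w (V b) - base)"
proof -
  obtain t where t: "0 < t" "t < 1" "p = (1 - t) *\<^sub>R V a + t *\<^sub>R V b"
    using assms(1) by (auto simp: in_segment)
  have "p - V a = of_real t * (V b - V a)" by (simp add: t algebra_simps scaleR_conv_of_real)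
  then have "W w p - W w (V a) = of_real t * (W w (V b) - W w (V a))" by (rule W_diff_scale)
  then have "W w p = W w (V a) + of_real t * (W w (V b) - W w (V a))" by (metis diff_add_cancel add.commute)
  then have "W w p - base = of_real (1 - t) * (W w (V a) - base) + of_real t * (W w (V b) - base)"
    by (simp add: algebra_simps)
  then show ?thesis using t by blast
qed

text \<open>The coordinates of the other two vertices vanish at \<open>v\<close>, so by
  \<open>next_side_val\<close> both are positive at the end of the first segment. This excludes all
  vertices and both sides at \<open>v\<close>, leaving the interior of the opposite side.\<close>

lemma gen_diag_first:
  assumes g: "gen_diag \<alpha> \<beta> v ps"
  shows "3 \<le> length ps" "ps ! 1 \<in> open_segment (V end_l) (V end_r)"
proof -
  note P = gen_diag_props[OF g]
  have lt: "0 + 1 < length ps" using P(1) by simp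
  have p0: "ps ! 0 = V v" using P(2) by (simp add: base_def)
  have pos: "0 < side_val i (ps ! 1)" if "i < 3" "i \<noteq> v" for i
    using next_side_val[OF P(4,5)[OF lt] that(1)] side_val_V(1)[OF that(1) v_less_3 that(2)] p0 by simp
  have lr: "0 < side_val end_l (ps ! 1)" "0 < side_val end_r (ps ! 1)" using pos end_props by auto
  have nv: "ps ! 1 \<notin> tri_verts \<alpha> \<beta>"
  proof
    assume t: "ps ! 1 \<in> tri_verts \<alpha> \<beta>"
    have "ps ! 1 = V end_r" using next_vertex[OF t lr(2)] end_props by simp
    moreover have "end_l \<noteq> end_r" using end_props(3) by simp
    ultimately show False using lr(1) side_val_V(1)[OF end_props(1,2)] by simp
  qed
  have "length ps \<noteq> 2"
  proof
    assume "length ps = 2"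
    then show False using P(3) nv by simp
  qed
  then show 3: "3 \<le> length ps" using P(1) by simp
  then obtain u where u: "on_side \<alpha> \<beta> (ps ! 1) u" using P(6)[of 1] by auto
  then obtain a b s where *: "a < 3" "b < 3" "s < 3" "distinct [a, b, s]" "ps ! 1 \<in> open_segment (V a) (V b)"
    by (rule on_side_cases) blast
  have "side_val s (ps ! 1) = 0" using side_val_open_segment[OF *(5,4,1-3)] by simp
  then have "s = v" using pos[OF *(3)] by auto
  then have "a \<noteq> v" "b \<noteq> v" "a \<noteq> b" using *(4) by auto
  moreover have "{end_l, end_r, v} = {0, 1, 2}"
    using end_props v_less_3 by (intro card_subset_eq) auto
  then have "a \<in> {end_l, end_r, v}" "b \<in> {end_l, end_r, v}" using *(1,2) by auto
  ultimately have "(a = end_l \<and> b = end_r) \<or> (a = end_r \<and> b = end_l)" by auto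
  then show "ps ! 1 \<in> open_segment (V end_l) (V end_r)"
    using *(5) by (auto simp: open_segment_commute)
qed

text \<open>Invariant for the unfolded diagonal: its \<open>j\<close>-th break point lies on the
  side just crossed and strictly inside the beam, the next segment prolongs the ray from the source,
  and this ray is the one through the first break point.\<close>

definition on_track :: "state \<Rightarrow> complex list \<Rightarrow> nat \<Rightarrow> bool" where
  "on_track T ps j \<longleftrightarrow> ps ! j \<in> open_segment (V (lab_l T)) (V (lab_r T)) \<and>
     sbetween (bd_r T - base) (W (word T) (ps ! j) - base) (bd_l T - base) \<and>
     (\<exists>c>0. W (word T) (ps ! (j + 1)) - W (word T) (ps ! j) = of_real c * (W (word T) (ps ! j) - base)) \<and>
     (\<exists>c>0. W (word T) (ps ! j) - base = of_real c * (ps ! 1 - base))"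

lemma on_track_start:
  assumes g: "gen_diag \<alpha> \<beta> v ps"
  shows "on_track start ps 1"
proof -
  note P = gen_diag_props[OF g] and F = gen_diag_first[OF g]
  have fix1: "R v (ps ! 1) = ps ! 1" by (rule R_open_segment[OF F(2)]) (use end_props v_less_3 in auto)
  obtain t where t: "0 < t" "t < 1" "W [] (ps ! 1) - base = of_real (1 - t) * (W [] (V end_l) - base) + of_real t * (W [] (V end_r) - base)"
    using W_open_segment[OF F(2)] by blast
  then have p1: "ps ! 1 - base = of_real (1 - t) * x0 + of_real t * y0" by (simp add: x0_def y0_def)
  have "cr y0 (ps ! 1 - base) = (1 - t) * cr y0 x0" "cr (ps ! 1 - base) x0 = t * cr y0 x0"
    unfolding p1 by (simp_all add: cr_alt algebra_simps)
  then have "sbetween y0 (ps ! 1 - base) x0" using t cr_y0_x0 by (simp add: sbetween_def)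
  moreover have "\<exists>c>0. R v (ps ! (1 + 1)) - R v (ps ! 1) = of_real c * (ps ! 1 - ps ! (1 - 1))"
    by (rule gen_diag_reflect[OF g _ _ F(2)]) (use end_props v_less_3 F in auto)
  ultimately show ?thesis
    using F(2) P(2) by (auto simp: on_track_def start_def fix1[unfolded One_nat_def] x0_def y0_def intro: exI[of _ 1])
qed

lemma on_track_advance:
  assumes g: "gen_diag \<alpha> \<beta> v ps" and T: "on_track T ps j" and j: "j + 2 < length ps"
    and q: "ps ! (j + 1) \<in> open_segment (V a) (V b)" "distinct [a, b, s]" "a < 3" "b < 3" "s < 3"
  shows "\<exists>k>0. W (s # word T) (ps ! (j + 1)) - base = of_real k * (W (word T) (ps ! j) - base)"
    "\<exists>c>0. W (s # word T) (ps ! (j + 2)) - W (s # word T) (ps ! (j + 1)) =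
       of_real c * (W (s # word T) (ps ! (j + 1)) - base)"
    "\<exists>c>0. W (s # word T) (ps ! (j + 1)) - base = of_real c * (ps ! 1 - base)"
proof -
  let ?p = "W (word T) (ps ! j)" and ?q = "W (word T) (ps ! (j + 1))"
  have fq: "W (s # word T) (ps ! (j + 1)) = ?q" using R_open_segment[OF q] by simp
  obtain c where c: "0 < c" "?q - ?p = of_real c * (?p - base)"
    using T by (auto simp: on_track_def)
  obtain d where d: "0 < d" "?p - base = of_real d * (ps ! 1 - base)"
    using T by (auto simp: on_track_def)
  have qp: "?q - base = of_real (1 + c) * (?p - base)"
    using c(2) by (simp add: algebra_simps)
  show "\<exists>k>0. W (s # word T) (ps ! (j + 1)) - base = of_real k * (?p - base)"
    unfolding fq using qp c(1) by (intro exI[of _ "1 + c"]) auto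
  show "\<exists>c>0. W (s # word T) (ps ! (j + 1)) - base = of_real c * (ps ! 1 - base)"
    unfolding fq using qp c(1) d by (intro exI[of _ "(1 + c) * d"]) auto
  obtain c' where c': "0 < c'" "R s (ps ! (j + 1 + 1)) - R s (ps ! (j + 1)) = of_real c' * (ps ! (j + 1) - ps ! (j + 1 - 1))"
    using gen_diag_reflect[OF g _ _ q] j by auto
  have "W (s # word T) (ps ! (j + 2)) - W (s # word T) (ps ! (j + 1)) = of_real c' * (?q - ?p)"
    using W_diff_scale[OF c'(2), of "word T"] by simp
  also have "\<dots> = of_real (c' * c / (1 + c)) * (?q - base)"
    unfolding c(2) qp using c(1) by (simp add: field_simps del: of_real_add)
  finally show "\<exists>c>0. W (s # word T) (ps ! (j + 2)) - W (s # word T) (ps ! (j + 1)) =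
       of_real c * (W (s # word T) (ps ! (j + 1)) - base)"
    unfolding fq using c(1) c'(1) by (intro exI[of _ "c' * c / (1 + c)"]) auto
qed

lemma on_track_apex_side:
  assumes g: "gen_diag \<alpha> \<beta> v ps" and T: "on_track T ps j" and valid: "valid T" and j: "j + 1 < length ps"
  shows "0 < side_val (lab_a T) (ps ! (j + 1))"
proof -
  note P = gen_diag_props[OF g]
  have "side_val (lab_a T) (ps ! j) = 0"
    using T valid side_val_open_segment[of "ps ! j" "lab_l T" "lab_r T" "lab_a T"]
    by (auto simp: on_track_def valid_def)
  then show ?thesis
    using next_side_val[OF P(4,5)[OF j]] valid by (auto simp: valid_def)
qed

text \<open>Unless the diagonal ends, it leaves the triangle through one of the two sides at the
  apex. The turn lemmas show that the matching child exists, whether or not the beam splits.\<close>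

lemma on_track_step:
  assumes g: "gen_diag \<alpha> \<beta> v ps" and T: "on_track T ps j" and valid: "valid T" and j: "j + 2 < length ps"
  shows "\<exists>T'\<in>set (children T). on_track T' ps (j + 1)"
proof -
  note P = gen_diag_props[OF g]
  obtain w i k e l r where S: "T = State w i k e l r" by (cases T)
  define x y z p where "x = W w (V i) - base" and "y = W w (V k) - base" and "z = W w (V e) - base"
    and "p = W w (ps ! j) - base"
  have lab: "distinct [i, k, e]" "i < 3" "k < 3" "e < 3" and B: "beam x y z (l - base) (r - base)"
    using valid by (auto simp: S valid_def x_def y_def z_def apex_def)
  have az: "apex T - base = z" by (simp add: S apex_def z_def)
  have s: "sbetween (r - base) p (l - base)" using T by (simp add: on_track_def S p_def)
  obtain b where b: "0 < b" "b < 1" "p = of_real (1 - b) * x + of_real b * y"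
    using W_open_segment[of "ps ! j" i k w] T by (auto simp: on_track_def S x_def y_def p_def)
  obtain u where u: "on_side \<alpha> \<beta> (ps ! (j + 1)) u" using P(6)[of "j + 1"] j by auto
  have j': "j + 1 < length ps" using j by simp
  have "0 < side_val e (ps ! (j + 1))" using on_track_apex_side[OF g T valid j'] by (simp add: S)
  from next_on_side[OF u this lab] show ?thesis
  proof
    assume q: "ps ! (j + 1) \<in> open_segment (V i) (V e)"
    have d: "distinct [i, e, k]" using lab by auto
    note A = on_track_advance[OF g T j q d lab(2,4,3)]
    have fq: "W (k # w) (ps ! (j + 1)) = W w (ps ! (j + 1))"
      using R_open_segment[OF q d] lab by simp
    obtain m where m: "0 < m" "W (k # w) (ps ! (j + 1)) - base = of_real m * p"
      using A(1) by (auto simp: S p_def)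
    obtain a where a: "0 < a" "a < 1" "W w (ps ! (j + 1)) - base = of_real (1 - a) * x + of_real a * z"
      using W_open_segment[OF q, of w] by (auto simp: x_def z_def)
    have eq: "of_real m * p = of_real (1 - a) * x + of_real a * z" using m(2) a(3) fq by simp
    note tl = turn_left[OF B b(1,2) a(1,2) m(1) b(3) eq s]
    \<comment> \<open>One definition covers both cases: the apex becomes the right bound exactly
      when the beam splits.\<close>
    define T' where "T' = State (k # w) i e k l (if splits T then apex T else r)"
    have "T' \<in> set (children T)"
      using tl(2) az by (auto simp: T'_def S children_def splits_def sbetween_def)
    moreover have "on_track T' ps (j + 1)"
    proof -
      have "sbetween (bd_r T' - base) (of_real m * p) (bd_l T' - base)"
        using tl s m(1) az by (auto simp: T'_def sbetween_def cr_scale)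
      then show ?thesis
        using q A(2,3) m(2) unfolding on_track_def by (simp add: T'_def S add.assoc)
    qed
    ultimately show ?thesis by blast
  next
    assume q: "ps ! (j + 1) \<in> open_segment (V e) (V k)"
    have d: "distinct [e, k, i]" using lab by auto
    note A = on_track_advance[OF g T j q d lab(4,3,2)]
    have fq: "W (i # w) (ps ! (j + 1)) = W w (ps ! (j + 1))"
      using R_open_segment[OF q d] lab by simp
    obtain m where m: "0 < m" "W (i # w) (ps ! (j + 1)) - base = of_real m * p"
      using A(1) by (auto simp: S p_def)
    obtain a where a: "0 < a" "a < 1" "W w (ps ! (j + 1)) - base = of_real (1 - a) * z + of_real a * y"
      using W_open_segment[OF q, of w] by (auto simp: y_def z_def)
    have eq: "of_real m * p = of_real (1 - a) * z + of_real a * y" using m(2) a(3) fq by simp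
    note tr = turn_right[OF B b(1,2) a(1,2) m(1) b(3) eq s]
    define T' where "T' = State (i # w) e k i (if splits T then apex T else l) r"
    have "T' \<in> set (children T)"
      using tr(2) az by (auto simp: T'_def S children_def splits_def sbetween_def)
    moreover have "on_track T' ps (j + 1)"
    proof -
      have "sbetween (bd_r T' - base) (of_real m * p) (bd_l T' - base)"
        using tr s m(1) az by (auto simp: T'_def sbetween_def cr_scale)
      then show ?thesis
        using q A(2,3) m(2) unfolding on_track_def by (simp add: T'_def S add.assoc)
    qed
    ultimately show ?thesis by blast
  qed
qed

lemma descendants_Suc_right: "T' \<in> set (descendants n T) \<Longrightarrow> T'' \<in> set (children T') \<Longrightarrow>
    T'' \<in> set (descendants (Suc n) T)"
  using descendants_add[of n 1 T] by auto

lemma gen_diag_track: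
  assumes g: "gen_diag \<alpha> \<beta> v ps"
  shows "n + 2 < length ps \<Longrightarrow> \<exists>T\<in>set (descendants n start). on_track T ps (n + 1)"
proof (induction n)
  case 0
  then show ?case using on_track_start[OF g] by simp
next
  case (Suc n)
  then obtain T where T: "T \<in> set (descendants n start)" "on_track T ps (n + 1)" by auto
  have "valid T" using valid_descendants[OF valid_start T(1)] .
  then obtain T' where "T' \<in> set (children T)" "on_track T' ps (Suc n + 1)"
    using on_track_step[OF g T(2)] Suc.prems by auto
  then show ?case using descendants_Suc_right[OF T(1)] by blast
qed

text \<open>With n + 3 break points there are n + 1 crossed sides, the first of which is already in
  \<open>start\<close>, so the final vertex is the apex of a beam of generation \<open>n\<close>. It
  lies on the unfolded ray, which has the initial direction.\<close>

lemma gen_diag_direction: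
  assumes g: "gen_diag \<alpha> \<beta> v ps"
  shows "\<exists>T\<in>set (descendants (length ps - 3) start). sgn (apex T - base) = sgn (ps ! 1 - ps ! 0)"
proof -
  note P = gen_diag_props[OF g] and F = gen_diag_first[OF g]
  define n where "n = length ps - 3"
  have n: "length ps = n + 3" using F by (simp add: n_def)
  obtain T where T: "T \<in> set (descendants n start)" "on_track T ps (n + 1)"
    using gen_diag_track[OF g, of n] n by auto
  have v: "valid T" using valid_descendants[OF valid_start T(1)] .
  have "0 < side_val (lab_a T) (ps ! (n + 1 + 1))"
    by (rule on_track_apex_side[OF g T(2) v]) (simp add: n)
  then have last: "ps ! (n + 1 + 1) = V (lab_a T)"
    using next_vertex[of "ps ! (n + 1 + 1)" "lab_a T"] P(3) v n by (simp add: valid_def)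
  obtain c d where c: "0 < c" "W (word T) (ps ! (n + 1 + 1)) - W (word T) (ps ! (n + 1)) = of_real c * (W (word T) (ps ! (n + 1)) - base)"
    and d: "0 < d" "W (word T) (ps ! (n + 1)) - base = of_real d * (ps ! 1 - base)"
    using T(2) unfolding on_track_def by blast
  have "apex T - base = of_real ((1 + c) * d) * (ps ! 1 - base)"
  proof -
    have "apex T - base = of_real c * (W (word T) (ps ! (n + 1)) - base) + (W (word T) (ps ! (n + 1)) - base)"
      using c(2) unfolding last apex_def by (metis diff_add_cancel add_diff_eq)
    then show ?thesis unfolding d(2) by (simp add: algebra_simps)
  qed
  moreover have "0 < (1 + c) * d" using c d by simp
  ultimately obtain m where "0 < m" "apex T - base = of_real m * (ps ! 1 - base)" by blast
  then have "sgn (apex T - base) = sgn (ps ! 1 - ps ! 0)"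
    unfolding P(2) by (simp add: sgn_mult sgn_of_real)
  then show ?thesis using T(1) by (auto simp: n_def)
qed

text \<open>Diagonals inject into directions, and these occur among the directions to apexes in the
  generations below \<open>n\<close>, each of which is no larger than generation
  \<open>n\<close>.\<close>

lemma diag_count_le: "diag_count \<alpha> \<beta> v n \<le> n * length (descendants n start)"
proof -
  define G where "G = {ps. gen_diag \<alpha> \<beta> v ps \<and> length ps \<le> n + 2}"
  define f where "f = (\<lambda>ps :: complex list. sgn (ps ! 1 - ps ! 0))"
  define D where "D = (\<lambda>j. (\<lambda>T. sgn (apex T - base)) ` set (descendants j start))"
  have inj: "inj_on f G" unfolding inj_on_def f_def G_def using gen_diag_inj by blast
  have sub: "f ` G \<subseteq> (\<Union>j\<in>{..<n}. D j)"
  proof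
    fix d assume "d \<in> f ` G"
    then obtain ps where ps: "gen_diag \<alpha> \<beta> v ps" "length ps \<le> n + 2" "d = f ps" by (auto simp: G_def)
    have "length ps - 3 < n" using ps(2) gen_diag_first(1)[OF ps(1)] by linarith
    moreover have "d \<in> D (length ps - 3)"
    proof -
      obtain T where "T \<in> set (descendants (length ps - 3) start)" "sgn (apex T - base) = f ps"
        using gen_diag_direction[OF ps(1)] by (auto simp: f_def)
      then show ?thesis unfolding D_def ps(3) by (intro image_eqI[of _ _ T]) simp_all
    qed
    ultimately show "d \<in> (\<Union>j\<in>{..<n}. D j)" by blast
  qed
  have "card G = card (f ` G)" using card_image[OF inj] by simp
  also have "\<dots> \<le> card (\<Union>j\<in>{..<n}. D j)" by (rule card_mono[OF _ sub]) (simp add: D_def)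
  also have "\<dots> \<le> (\<Sum>j<n. card (D j))" by (rule card_UN_le) simp
  also have "\<dots> \<le> (\<Sum>j<n. length (descendants n start))"
  proof (rule sum_mono)
    fix j assume "j \<in> {..<n}"
    have "card (D j) \<le> card (set (descendants j start))" unfolding D_def by (rule card_image_le) simp
    also have "\<dots> \<le> length (descendants j start)" by (rule card_length)
    also have "\<dots> \<le> length (descendants n start)"
      using \<open>j \<in> {..<n}\<close> by (intro length_descendants_mono) simp
    finally show "card (D j) \<le> length (descendants n start)" .
  qed
  finally show ?thesis by (simp add: diag_count_def G_def)
qed

end

section \<open>Separation of unfolded vertices for almost every triangle\<close>

definition label_words :: "nat \<Rightarrow> (nat list \<times> nat) set" where
  "label_words k = {u. set u \<subseteq> {..<3} \<and> length u \<le> k} \<times> {..<3}"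

lemma finite_label_words: "finite (label_words k)"
  unfolding label_words_def by (intro finite_cartesian_product finite_lists_length_le) auto

lemma card_label_words: "card (label_words k) \<le> 3 ^ (k + 2)"
proof -
  have "(\<Sum>i\<le>k. (3::nat) ^ i) \<le> 3 ^ (k + 1)"
    by (induction k) auto
  moreover have "card (label_words k) = (\<Sum>i\<le>k. 3 ^ i) * 3"
    unfolding label_words_def card_cartesian_product by (subst card_lists_length_le) auto
  ultimately show ?thesis by simp
qed

definition gap :: "nat \<Rightarrow> real" where
  "gap k = exp (- (real k powr (11/5)))"

lemma gap_bounds: "0 < gap k" "gap k \<le> 1"
  by (auto simp: gap_def)

text \<open>Borel-Cantelli over \<open>k\<close>. The exceptional set \<open>A k\<close> collects
  the sublevel sets of all triples whose area polynomial is not identically zero; for the remaining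
  triples the area is zero in every triangle.\<close>

lemma AE_separated:
  "AE x in (lborel :: (real \<times> real) measure). 0 < fst x \<and> 0 < snd x \<and> fst x + snd x < pi \<longrightarrow>
     (\<forall>\<^sub>F k in sequentially. separated (fst x) (snd x) k (gap k / 8))"
proof -
  define I where "I = (\<lambda>k. label_words k \<times> label_words k \<times> label_words k)"
  define Q where "Q = (\<lambda>\<alpha> \<beta> (u, e). unfold_word \<alpha> \<beta> u (tri_vert \<alpha> \<beta> e))"
  define d where "d = (\<lambda>k::nat. 2 + 4 * k)"
  have fin: "finite (I k)" for k by (simp add: I_def finite_label_words)
  have rep: "trig_rep (1 + 2 * k) (\<lambda>\<alpha> \<beta>. Q \<alpha> \<beta> w)" if "w \<in> label_words k" for k w
  proof (cases w)
    case (Pair u e)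
    have "trig_rep (1 + 2 * length u) (\<lambda>\<alpha> \<beta>. unfold_word \<alpha> \<beta> u (tri_vert \<alpha> \<beta> e))"
      by (intro trig_rep_unfold_word trig_rep_vert)
    then show ?thesis using that Pair
      by (auto simp: Q_def label_words_def elim!: trig_rep_mono)
  qed
  define P where "P = (\<lambda>k t G. trig_poly (d k) G \<and> (\<forall>\<alpha> \<beta>. sin (\<alpha> + \<beta>) \<noteq> 0 \<longrightarrow>
      norm (G \<alpha> \<beta>) = 2 * (norm (cis (2 * (\<alpha> + \<beta>)) - 1))\<^sup>2 *
        \<bar>orient (Q \<alpha> \<beta> (fst t)) (Q \<alpha> \<beta> (fst (snd t))) (Q \<alpha> \<beta> (snd (snd t)))\<bar>))"
  have ex: "\<exists>G. P k t G" if "t \<in> I k" for k t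
  proof -
    have "1 + 2 * k + (1 + 2 * k) = d k" by (simp add: d_def)
    moreover have "fst t \<in> label_words k" "fst (snd t) \<in> label_words k" "snd (snd t) \<in> label_words k"
      using that by (auto simp: I_def)
    ultimately show ?thesis
      using trig_poly_orient[OF rep[of "fst t" k] rep[of "fst (snd t)" k] rep[of "snd (snd t)" k]]
      unfolding P_def by (simp only:)
  qed
  define G where "G = (\<lambda>k t. SOME G. P k t G)"
  have PG: "P k t (G k t)" if "t \<in> I k" for k t
    unfolding G_def by (rule someI_ex[OF ex[OF that]])
  have G: "trig_poly (d k) (G k t)"
    "\<And>\<alpha> \<beta>. sin (\<alpha> + \<beta>) \<noteq> 0 \<Longrightarrow>
      norm (G k t \<alpha> \<beta>) = 2 * (norm (cis (2 * (\<alpha> + \<beta>)) - 1))\<^sup>2 *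
        \<bar>orient (Q \<alpha> \<beta> (fst t)) (Q \<alpha> \<beta> (fst (snd t))) (Q \<alpha> \<beta> (snd (snd t)))\<bar>"
    if "t \<in> I k" for k t
    using PG[OF that] unfolding P_def by blast+
  define J where "J = (\<lambda>k. {t \<in> I k. \<exists>a b. G k t a b \<noteq> 0})"
  define B where "B = (\<lambda>k t. {x \<in> {0<..<pi} \<times> {0<..<pi}. norm (G k t (fst x) (snd x)) < gap k})"
  define A where "A = (\<lambda>k. \<Union>t\<in>J k. B k t)"
  define \<kappa> where "\<kappa> = (\<lambda>k. 48 * pi * real (d k) * gap k powr (1 / (4 * real (d k))))"
  have finJ: "finite (J k)" for k unfolding J_def using fin by auto
  have B: "B k t \<in> sets lborel" "emeasure lborel (B k t) \<le> ennreal (\<kappa> k)" if t: "t \<in> J k" for k t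
  proof -
    obtain a b where "t \<in> I k" "G k t a b \<noteq> 0" using t by (auto simp: J_def)
    moreover have "1 \<le> d k" by (simp add: d_def)
    ultimately show "B k t \<in> sets lborel" "emeasure lborel (B k t) \<le> ennreal (\<kappa> k)"
      unfolding B_def \<kappa>_def using emeasure_sublevel_trig_poly_int[OF G(1) _ _ gap_bounds] by blast+
  qed
  have \<kappa>0: "0 \<le> \<kappa> k" for k by (simp add: \<kappa>_def)
  have cardJ: "card (J k) \<le> 27 ^ (k + 2)" for k
  proof -
    have "card (J k) \<le> card (I k)" unfolding J_def by (intro card_mono fin) auto
    also have "\<dots> = card (label_words k) * (card (label_words k) * card (label_words k))"
      by (simp add: I_def card_cartesian_product)
    also have "\<dots> \<le> 3 ^ (k + 2) * (3 ^ (k + 2) * 3 ^ (k + 2))"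
      by (intro mult_le_mono card_label_words)
    also have "\<dots> = 27 ^ (k + 2)" by (simp add: power_mult_distrib[symmetric] mult.assoc[symmetric])
    finally show ?thesis .
  qed
  have A: "A k \<in> sets lborel" "emeasure lborel (A k) \<le> ennreal (27 ^ (k + 2) * \<kappa> k)" for k
  proof -
    show "A k \<in> sets lborel" unfolding A_def using B finJ by (intro sets.finite_UN) auto
    have "emeasure lborel (A k) \<le> (\<Sum>t\<in>J k. emeasure lborel (B k t))"
      unfolding A_def using B finJ by (intro emeasure_subadditive_finite) auto
    also have "\<dots> \<le> (\<Sum>t\<in>J k. ennreal (\<kappa> k))" by (intro sum_mono B)
    also have "\<dots> = ennreal (real (card (J k)) * \<kappa> k)"
      using \<kappa>0 by (simp add: ennreal_mult ennreal_of_nat_eq_real_of_nat)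
    also have "\<dots> \<le> ennreal (real (27 ^ (k + 2)) * \<kappa> k)"
      using \<kappa>0 cardJ by (intro ennreal_leI mult_right_mono of_nat_mono)
    finally show "emeasure lborel (A k) \<le> ennreal (27 ^ (k + 2) * \<kappa> k)" by simp
  qed
  have summ: "summable (\<lambda>k. 27 ^ (k + 2) * \<kappa> k)"
  proof (rule summable_comparison_test_bigo)
    show "summable (\<lambda>k. norm (1 / real k ^ 2))"
      using inverse_power_summable[of 2] by (simp add: divide_inverse)
    \<comment> \<open>The exponent is of order k^(6/5)/16, superlinear in k because 11/5 > 2, so it
      beats 27^k.\<close>
    have "(\<lambda>k. 27 ^ (k + 2) * (48 * pi * (2 + 4 * real k) * exp (- (real k powr (11/5)) / (8 + 16 * real k))))
        \<in> O(\<lambda>k. 1 / real k ^ 2)"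
      by real_asymp
    moreover have "\<kappa> k = 48 * pi * (2 + 4 * real k) * exp (- (real k powr (11/5)) / (8 + 16 * real k))" for k
      by (simp add: \<kappa>_def d_def gap_def powr_def)
    ultimately show "(\<lambda>k. 27 ^ (k + 2) * \<kappa> k) \<in> O(\<lambda>k. 1 / real k ^ 2)" by simp
  qed
  have mA: "measure lborel (A k) \<le> 27 ^ (k + 2) * \<kappa> k" for k
    unfolding measure_def using A(2)[of k] \<kappa>0[of k] by (intro enn2real_leI) auto
  have "norm (measure lborel (A k)) \<le> 27 ^ (k + 2) * \<kappa> k" for k
    unfolding real_norm_def abs_of_nonneg[OF measure_nonneg] by (rule mA)
  then have "summable (\<lambda>k. measure lborel (A k))"
    by (rule summable_comparison_test'[OF summ, of 0])
  moreover have "emeasure lborel (A k) < \<infinity>" for k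
    using A(2)[of k] le_less_trans ennreal_less_top by (metis infinity_ennreal_def)
  ultimately have "AE x in lborel. \<forall>\<^sub>F k in sequentially. x \<in> space lborel - A k"
    by (intro borel_cantelli_AE1 A(1))
  then show ?thesis
  proof eventually_elim
    case (elim x)
    show ?case
    proof (intro impI)
      assume x: "0 < fst x \<and> 0 < snd x \<and> fst x + snd x < pi"
      define \<alpha> \<beta> where "\<alpha> = fst x" and "\<beta> = snd x"
      have box: "x \<in> {0<..<pi} \<times> {0<..<pi}" using x by (auto simp: mem_Times_iff)
      have "0 < sin (\<alpha> + \<beta>)" using x by (auto simp: \<alpha>_def \<beta>_def intro!: sin_gt_zero)
      then have s: "sin (\<alpha> + \<beta>) \<noteq> 0" by simp
      define m where "m = norm (cis (2 * (\<alpha> + \<beta>)) - 1)"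
      have "m = 2 * \<bar>sin (\<alpha> + \<beta>)\<bar>"
        unfolding m_def cis_double_minus_1 by (simp add: norm_mult)
      then have m: "0 < m" "m \<le> 2" using s by auto
      show "\<forall>\<^sub>F k in sequentially. separated (fst x) (snd x) k (gap k / 8)"
        using elim
      proof eventually_elim
        case (elim k)
        have main: "orient (Q \<alpha> \<beta> w1) (Q \<alpha> \<beta> w2) (Q \<alpha> \<beta> w3) = 0 \<or>
            gap k / 8 \<le> \<bar>orient (Q \<alpha> \<beta> w1) (Q \<alpha> \<beta> w2) (Q \<alpha> \<beta> w3)\<bar>"
          if w: "w1 \<in> label_words k" "w2 \<in> label_words k" "w3 \<in> label_words k" for w1 w2 w3
        proof -
          define t where "t = (w1, w2, w3)"
          have t: "t \<in> I k" using w by (simp add: t_def I_def)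
          define a where "a = \<bar>orient (Q \<alpha> \<beta> w1) (Q \<alpha> \<beta> w2) (Q \<alpha> \<beta> w3)\<bar>"
          have n: "norm (G k t \<alpha> \<beta>) = 2 * m\<^sup>2 * a"
            using G(2)[OF t s] by (simp add: m_def a_def t_def)
          show ?thesis
          proof (cases "t \<in> J k")
            case True
            then have "x \<notin> B k t" using elim by (auto simp: A_def)
            then have "gap k \<le> 2 * m\<^sup>2 * a" using box n by (simp add: B_def \<alpha>_def \<beta>_def)
            \<comment> \<open>Origin of the 8 in the separation bound: the scaling factor has
              modulus at most 2.\<close>
            also have "\<dots> \<le> 2 * 2\<^sup>2 * a"
              using m by (intro mult_right_mono mult_left_mono power_mono) (auto simp: a_def)
            finally show ?thesis by (simp add: a_def)
          next
            case False
            then have "2 * m\<^sup>2 * a = 0" using t n by (simp add: J_def)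
            then show ?thesis using m by (simp add: a_def)
          qed
        qed
        show ?case
          unfolding separated_def
        proof (intro allI impI)
          fix u1 u2 u3 :: "nat list" and e1 e2 e3 :: nat
          assume "length u1 \<le> k \<and> length u2 \<le> k \<and> length u3 \<le> k \<and>
            set u1 \<subseteq> {..<3} \<and> set u2 \<subseteq> {..<3} \<and> set u3 \<subseteq> {..<3} \<and> e1 < 3 \<and> e2 < 3 \<and> e3 < 3"
          then show "orient (unfold_word (fst x) (snd x) u1 (tri_vert (fst x) (snd x) e1))
              (unfold_word (fst x) (snd x) u2 (tri_vert (fst x) (snd x) e2))
              (unfold_word (fst x) (snd x) u3 (tri_vert (fst x) (snd x) e3)) = 0 \<or>
            gap k / 8 \<le> \<bar>orient (unfold_word (fst x) (snd x) u1 (tri_vert (fst x) (snd x) e1))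
              (unfold_word (fst x) (snd x) u2 (tri_vert (fst x) (snd x) e2))
              (unfold_word (fst x) (snd x) u3 (tri_vert (fst x) (snd x) e3))\<bar>"
            using main[of "(u1, e1)" "(u2, e2)" "(u3, e3)"]
            by (simp add: label_words_def Q_def \<alpha>_def \<beta>_def)
        qed
      qed
    qed
  qed
qed

section \<open>Growth of the number of generalized diagonals\<close>

context pointed_triangle
begin

lemma diag_count_subexponential:
  assumes sep: "\<forall>\<^sub>F k in sequentially. separated \<alpha> \<beta> k (gap k / 8)"
  shows "\<forall>\<^sub>F n in sequentially. real (diag_count \<alpha> \<beta> v n) < exp (real n powr (73/100))"
proof -
  obtain M where M0: "0 < M" and M: "\<forall>w e. set w \<subseteq> {..<3} \<and> e < 3 \<longrightarrow> weight (W w (V e) - base) \<le> M * real (length w + 1)"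
    using weight_bound by blast
  define D where "D = cr y0 x0"
  have D: "0 < D" using cr_y0_x0 by (simp add: D_def)
  define k where "k = (\<lambda>n. nat \<lceil>real n powr (3/10)\<rceil>)"
  have k_lim: "filterlim k at_top sequentially"
    unfolding k_def by real_asymp
  have sep_k: "\<forall>\<^sub>F n in sequentially. separated \<alpha> \<beta> (k n) (gap (k n) / 8)"
    using sep k_lim by (rule eventually_compose_filterlim)
  \<comment> \<open>On the right the exponent is a constant times n^(66/100), since 3/10 times 11/5
    is 66/100; this is below n^(7/10).\<close>
  have small: "\<forall>\<^sub>F n in sequentially. 3 * (M * (4 * real n))\<^sup>2 * exp (- (real n powr (7/10))) <
      exp (- ((2 * real n powr (3/10)) powr (11/5))) / 8 * D"
    using M0 D by real_asymp
  \<comment> \<open>The logarithm of the left side is O(n^(7/10) log n).\<close>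
  have final: "\<forall>\<^sub>F n in sequentially. real n * ((4 * real n powr (3/10) + 1) powr (real n powr (7/10) + 1) *
      (1 + (real n powr (7/10) + 1) * (2 powr (2 * real n powr (3/10)) / exp (- (real n powr (7/10)))))) < exp (real n powr (73/100))"
    by real_asymp
  show ?thesis
    using sep_k small final eventually_ge_at_top[of 1]
  proof eventually_elim
    case (elim n)
    define \<delta> where "\<delta> = exp (- (real n powr (7/10)))"
    \<comment> \<open>Rounding up gives n \<le> q k \<le> 2n; the overshoot is harmless because
      generations only grow.\<close>
    define q where "q = n div k n + 1"
    have n1: "1 \<le> real n" using elim by simp
    have p1: "1 \<le> real n powr (3/10)" using n1 by (simp add: ge_one_powr_ge_zero)
    have k_ge: "real n powr (3/10) \<le> real (k n)" unfolding k_def by linarith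
    have "real (k n) \<le> real n powr (3/10) + 1" unfolding k_def using p1 by linarith
    then have k_le: "real (k n) \<le> 2 * real n powr (3/10)" using p1 by linarith
    have "real n powr (3/10) \<le> real n powr 1" using n1 by (intro powr_mono) auto
    then have "\<lceil>real n powr (3/10)\<rceil> \<le> int n" using n1 by (intro ceiling_le) auto
    then have kn: "k n \<le> n" unfolding k_def nat_le_iff .
    have k0: "0 < k n" using k_ge p1 by (cases "k n = 0") auto
    have qk: "q * k n = n div k n * k n + k n" by (simp add: q_def)
    have "n = n div k n * k n + n mod k n" by simp
    then have n_le: "n \<le> q * k n" using mod_less_divisor[OF k0, of n] qk by linarith
    have "n div k n * k n \<le> n" by simp
    then have "q * k n + 2 \<le> 4 * n" using qk kn \<open>1 \<le> n\<close> by linarith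
    then have "real (q * k n + 2) \<le> real (4 * n)" by (simp only: of_nat_le_iff)
    then have qk_le: "real (q * k n + 2) \<le> 4 * real n" by simp
    have "real (n div k n) \<le> real n / real (k n)" by (rule of_nat_div_le_of_nat)
    also have "\<dots> \<le> real n / real n powr (3/10)"
      using k_ge p1 n1 by (intro divide_left_mono mult_pos_pos) auto
    also have "\<dots> = real n powr (7/10)"
      using n1 powr_diff[of "real n" 1 "3/10"] by simp
    finally have q_le: "real q \<le> real n powr (7/10) + 1" by (simp add: q_def)
    have "real (k n) powr (11/5) \<le> (2 * real n powr (3/10)) powr (11/5)"
      using k_le by (intro powr_mono2) auto
    then have gap_ge: "exp (- ((2 * real n powr (3/10)) powr (11/5))) \<le> gap (k n)"
      by (simp add: gap_def)
    have "3 * (M * real (q * k n + 2))\<^sup>2 * \<delta> \<le> 3 * (M * (4 * real n))\<^sup>2 * \<delta>"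
      using M0 qk_le by (intro mult_right_mono mult_left_mono power_mono) (auto simp: \<delta>_def)
    also have "\<dots> < exp (- ((2 * real n powr (3/10)) powr (11/5))) / 8 * D"
      using elim by (simp add: \<delta>_def)
    also have "\<dots> \<le> gap (k n) / 8 * D"
      using gap_ge D by (intro mult_right_mono divide_right_mono) auto
    finally have sm: "3 * (M * real (q * k n + 2))\<^sup>2 * \<delta> < gap (k n) / 8 * cr y0 x0"
      by (simp add: D_def)
    have "real (length (descendants n start)) \<le> real (length (descendants (q * k n) start))"
      using length_descendants_mono[OF n_le] by simp
    also have "\<dots> \<le> (2 * real (k n) + 1) ^ q * (1 + real q * (2 ^ k n / \<delta>))"
      by (rule count_iterate[OF M M0 _ _ sm]) (use elim in \<open>auto simp: \<delta>_def\<close>)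
    also have "\<dots> \<le> (4 * real n powr (3/10) + 1) powr (real n powr (7/10) + 1) *
      (1 + (real n powr (7/10) + 1) * (2 powr (2 * real n powr (3/10)) / \<delta>))"
    proof (intro mult_mono add_mono order_refl divide_right_mono)
      have "(2 * real (k n) + 1) ^ q = (2 * real (k n) + 1) powr real q"
        by (simp add: powr_realpow add_nonneg_pos)
      also have "\<dots> \<le> (4 * real n powr (3/10) + 1) powr real q"
        using k_le by (intro powr_mono2) auto
      also have "\<dots> \<le> (4 * real n powr (3/10) + 1) powr (real n powr (7/10) + 1)"
        using q_le p1 by (intro powr_mono) auto
      finally show "(2 * real (k n) + 1) ^ q \<le> (4 * real n powr (3/10) + 1) powr (real n powr (7/10) + 1)" .
      have "(2::real) ^ k n = 2 powr real (k n)" by (simp add: powr_realpow)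
      also have "\<dots> \<le> 2 powr (2 * real n powr (3/10))" using k_le by (intro powr_mono) auto
      finally show "(2::real) ^ k n \<le> 2 powr (2 * real n powr (3/10))" .
    qed (use q_le in \<open>auto simp: \<delta>_def\<close>)
    finally have len: "real (length (descendants n start)) \<le> (4 * real n powr (3/10) + 1) powr (real n powr (7/10) + 1) *
      (1 + (real n powr (7/10) + 1) * (2 powr (2 * real n powr (3/10)) / \<delta>))" .
    have "real (diag_count \<alpha> \<beta> v n) \<le> real n * real (length (descendants n start))"
      using diag_count_le[of n] by (metis of_nat_le_iff of_nat_mult)
    also have "\<dots> \<le> real n * ((4 * real n powr (3/10) + 1) powr (real n powr (7/10) + 1) *
      (1 + (real n powr (7/10) + 1) * (2 powr (2 * real n powr (3/10)) / \<delta>)))"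
      by (intro mult_left_mono len) simp
    also have "\<dots> < exp (real n powr (73/100))"
      using elim by (simp add: \<delta>_def)
    finally show ?case .
  qed
qed

end

section \<open>Gaps in the enumeration of a cofinite set\<close>

text \<open>Past \<open>N\<close> the enumeration runs through consecutive integers, so the gap is
  at most 1. The \<open>i\<close>-th element is at least \<open>i\<close>, and from 2 on the
  right-hand side exceeds 1.\<close>

lemma enumerate_gap_cofinite:
  fixes S :: "nat set"
  assumes S: "\<forall>\<^sub>F n in sequentially. n \<in> S" and \<epsilon>: "0 < \<epsilon>"
  shows "infinite S"
    and "\<forall>\<^sub>F i in sequentially. real (enumerate S (Suc i)) - real (enumerate S i) < real (enumerate S i) powr (1 + \<epsilon>)"
proof -
  obtain N where N: "\<And>n. N \<le> n \<Longrightarrow> n \<in> S" using S by (auto simp: eventually_sequentially)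
  then have "{N..} \<subseteq> S" by auto
  then show inf: "infinite S" using infinite_Ici infinite_super by blast
  show "\<forall>\<^sub>F i in sequentially. real (enumerate S (Suc i)) - real (enumerate S i) < real (enumerate S i) powr (1 + \<epsilon>)"
    using eventually_ge_at_top[of "max N 2"]
  proof eventually_elim
    case (elim i)
    define s where "s = enumerate S i"
    have s: "max N 2 \<le> s" using le_enumerate[OF inf, of i] elim by (simp add: s_def)
    have "enumerate S (Suc i) \<le> Suc s"
      unfolding enumerate_Suc''[OF inf] s_def[symmetric] by (rule Least_le) (use s N in auto)
    then have "real (enumerate S (Suc i)) - real s \<le> 1" by linarith
    also have "1 < real s powr (1 + \<epsilon>)" using s \<epsilon> by (intro gr_one_powr) auto
    finally show ?case by (simp add: s_def)
  qed
qed

theorem theorem4p3: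
  shows "AE x in (lborel :: (real \<times> real) measure).
    (0 < fst x \<and> 0 < snd x \<and> fst x + snd x < pi) \<longrightarrow>
    (\<forall>v::nat. v < 3 \<longrightarrow> (\<forall>\<mu>::real. sqrt 3 - 1 < \<mu> \<longrightarrow>
      (let S = {n::nat. 0 < n \<and> real (diag_count (fst x) (snd x) v n) < exp (real n powr \<mu>)}
       in infinite S \<and>
          (\<forall>\<epsilon>::real. 0 < \<epsilon> \<longrightarrow>
             (\<forall>\<^sub>F i in sequentially.
                real (enumerate S (Suc i)) - real (enumerate S i)
                  < real (enumerate S i) powr (1 + \<epsilon>))))))"
  using AE_separated
proof eventually_elim
  case (elim x)
  show ?case
  proof (intro impI allI)
    fix v :: nat and \<mu> :: real
    assume x: "0 < fst x \<and> 0 < snd x \<and> fst x + snd x < pi" and v: "v < 3" and \<mu>: "sqrt 3 - 1 < \<mu>"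
    interpret pointed_triangle "fst x" "snd x" v
      using x v by unfold_locales auto
    define S where "S = {n::nat. 0 < n \<and> real (diag_count (fst x) (snd x) v n) < exp (real n powr \<mu>)}"
    \<comment> \<open>Since 1.73^2 = 2.9929 < 3, the exponent 73/100 lies below every admissible
      \<mu>.\<close>
    have "173 / 100 \<le> sqrt 3" by (intro real_le_rsqrt) (simp add: power2_eq_square)
    then have \<mu>': "73/100 \<le> \<mu>" using \<mu> by linarith
    have "\<forall>\<^sub>F n in sequentially. real (diag_count (fst x) (snd x) v n) < exp (real n powr (73/100))"
      by (rule diag_count_subexponential) (use elim x in blast)
    then have "\<forall>\<^sub>F n in sequentially. n \<in> S"
      using eventually_ge_at_top[of 1]
    proof eventually_elim
      case (elim n)
      have "real n powr (73/100) \<le> real n powr \<mu>" using elim \<mu>' by (intro powr_mono) auto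
      then have "exp (real n powr (73/100)) \<le> exp (real n powr \<mu>)" by simp
      with elim(1) have "real (diag_count (fst x) (snd x) v n) < exp (real n powr \<mu>)" by linarith
      then show ?case using elim(2) by (simp add: S_def)
    qed
    then have "infinite S \<and> (\<forall>\<epsilon>>0. \<forall>\<^sub>F i in sequentially.
        real (enumerate S (Suc i)) - real (enumerate S i) < real (enumerate S i) powr (1 + \<epsilon>))"
      using enumerate_gap_cofinite[of S] zero_less_one by blast
    then show "let S = {n::nat. 0 < n \<and> real (diag_count (fst x) (snd x) v n) < exp (real n powr \<mu>)}
       in infinite S \<and>
          (\<forall>\<epsilon>::real. 0 < \<epsilon> \<longrightarrow>
             (\<forall>\<^sub>F i in sequentially.
                real (enumerate S (Suc i)) - real (enumerate S i)
                  < real (enumerate S i) powr (1 + \<epsilon>)))"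
      unfolding Let_def S_def[symmetric] .
  qed
qed

end
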